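(* Consider two neighbouring sites $j,j+1$ with parameters $x_j,x_{j+1}>0$ in the single-species PushTASEP. Regard the output flux process $R=F_{j+1,j+2}$ on the time-interval $[0,\infty)$ as a function $R(L,A,B,\eta_{01})$ of: the input flux process $L=F_{j-1,j}$ on $[0,\infty)$; the Poisson processes $A$ and $B$ of bells at sites $j$ and $j+1$ respectively; and the time-$0$ occupancies $\eta_{01}=(\eta_j,\eta_{j+1})\in\{0,1\}^2$ of sites $j$ and $j+1$. Then there exists a coupling of $$(A,B)\sim\mathrm{PP}\Big(\frac1{x_j}\Big)\otimes\mathrm{PP}\Big(\frac1{x_{j+1}}\Big)\quad\text{and}\quad(\widetilde A,\widetilde B)\sim\mathrm{PP}\Big(\frac1{x_{j+1}}\Big)\otimes\mathrm{PP}\Big(\frac1{x_j}\Big)$$ with the property that for every locally finite $L$, and for every $\eta_{01}\in\{(0,0),(1,1),(1,0)\}$, $$R(L,A,B,\eta_{01})=R(L,\widetilde A,\widetilde B,\eta_{01})$$ with probability $1$.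
   Context: $\mathrm{PP}(\rho)$ denotes (the law of) a Poisson process of rate $\rho$, and $\otimes$ denotes independence. **Single-species PushTASEP on a one-dimensional lattice.** Each site is occupied by a particle ($1$) or empty ($0$). When a bell rings at site $j$: if $j$ is empty, nothing happens; if $j$ is occupied, then $j$ becomes empty and the first empty site $k$ to the right of $j$ becomes occupied (a "transfer of a particle from $j$ to $k$"). The flux process $F_{j,j+1}$ is the point process of times at which there is a transfer of a particle from $j$ or a site to its left to $j+1$ or a site to its right. **The function $R$.** Explicitly, the occupancies $(\eta_j,\eta_{j+1})$ of the two sites start from $\eta_{01}$ at time $0$ and evolve as follows. - At a point of $L$ (a particle entering from the left): if $j$ is empty, $j$ becomes occupied; if $j$ is occupied and $j+1$ is empty, $j+1$ becomes occupied; if both are occupied, the occupancies are unchanged and $R$ has a point at that time. - At a bell at $j$ (a point of $A$, resp. $\widetilde A$): if $j$ is empty nothing happens; if $j$ is occupied it becomes empty, and then $j+1$ becomes occupied if it was empty, while if $j+1$ was occupied it stays occupied and $R$ has a point at that time. - At a bell at $j+1$ (a point of $B$, resp. $\widetilde B$): if $j+1$ is empty nothing happens; if it is occupied it becomes empty and $R$ has a point at that time. Here $L$ is a locally finite set of points in $[0,\infty)$; almost surely the bell processes share no points with $L$ or with each other within each pair. *)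

theory Defs
  imports "HOL-Probability.Probability"
begin

section \<open>Locally finite point sets and Poisson processes on the half-line\<close>

definition locally_finite_points :: "real set set" where
  "locally_finite_points = {S. S \<subseteq> {0..} \<and> (\<forall>t. finite (S \<inter> {0..t}))}"

text \<open>The usual cylinder sigma-algebra, generated by the counts in bounded intervals.\<close>

definition point_space :: "real set measure" where
  "point_space = sigma locally_finite_points
     {{S \<in> locally_finite_points. card (S \<inter> {s..<t}) = n} | s t n. 0 \<le> s \<and> s < t}"

text \<open>
  Independent Poisson counts over disjoint intervals. Intervals are closed on the left so that the
  whole of the half-line, including the time 0, is covered. Only intervals of positive length get a
  distribution, since \<^const>\<open>poisson_pmf\<close> is specified for positive parameters only.
\<close>

definition poisson_process :: "'w measure \<Rightarrow> real \<Rightarrow> ('w \<Rightarrow> real set) \<Rightarrow> bool" where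
  "poisson_process M \<rho> X \<longleftrightarrow>
     X \<in> M \<rightarrow>\<^sub>M point_space \<and>
     (\<forall>s t. 0 \<le> s \<and> s < t \<longrightarrow>
        distr M (count_space UNIV) (\<lambda>\<omega>. card (X \<omega> \<inter> {s..<t}))
          = measure_pmf (poisson_pmf (\<rho> * (t - s)))) \<and>
     (\<forall>t :: nat \<Rightarrow> real. 0 \<le> t 0 \<and> mono t \<longrightarrow>
        prob_space.indep_vars M (\<lambda>_. count_space UNIV)
          (\<lambda>i \<omega>. card (X \<omega> \<inter> {t i..<t (Suc i)})) UNIV)"

text \<open>The law of the pair \<open>(X, Y)\<close> is the product of the laws \<open>PP(\<rho>)\<close> and \<open>PP(\<sigma>)\<close>.\<close>

definition indep_poisson_processes ::
    "'w measure \<Rightarrow> real \<Rightarrow> real \<Rightarrow> ('w \<Rightarrow> real set) \<Rightarrow> ('w \<Rightarrow> real set) \<Rightarrow> bool" where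
  "indep_poisson_processes M \<rho> \<sigma> X Y \<longleftrightarrow>
     poisson_process M \<rho> X \<and> poisson_process M \<sigma> Y \<and>
     prob_space.indep_var M point_space X point_space Y"


section \<open>Two neighbouring sites of the PushTASEP\<close>

datatype event = Arrival | Bell_left | Bell_right

text \<open>
  The state gives the occupancies of the two sites. The second component of the result tells
  whether a particle leaves the right-hand site to the right.
\<close>

fun step :: "event \<Rightarrow> bool \<times> bool \<Rightarrow> (bool \<times> bool) \<times> bool" where
  "step Arrival (False, b) = ((True, b), False)"
| "step Arrival (True, False) = ((True, True), False)"
| "step Arrival (True, True) = ((True, True), True)"
| "step Bell_left (False, b) = ((False, b), False)"
| "step Bell_left (True, False) = ((False, True), False)"
| "step Bell_left (True, True) = ((False, True), True)"
| "step Bell_right (a, False) = ((a, False), False)"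
| "step Bell_right (a, True) = ((a, False), True)"

text \<open>
  At times belonging to several of \<open>L\<close>, \<open>A\<close>, \<open>B\<close> an arbitrary choice is made. For a fixed \<open>L\<close>
  and independent Poisson processes \<open>A\<close>, \<open>B\<close> there are almost surely no such times.
\<close>

definition event_at :: "real set \<Rightarrow> real set \<Rightarrow> real set \<Rightarrow> real \<Rightarrow> event" where
  "event_at L A B t = (if t \<in> L then Arrival else if t \<in> A then Bell_left else Bell_right)"

text \<open>
  The occupancies just before time \<open>t\<close>, obtained by applying the events in \<open>[0, t)\<close> in increasing
  order of time. This is meaningful for locally finite \<open>L\<close>, \<open>A\<close>, \<open>B\<close> only, as
  \<^const>\<open>sorted_list_of_set\<close> is the empty list on infinite sets.
\<close>

definition occupancies_before ::
    "real set \<Rightarrow> real set \<Rightarrow> real set \<Rightarrow> bool \<times> bool \<Rightarrow> real \<Rightarrow> bool \<times> bool" where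
  "occupancies_before L A B \<eta> t =
     fold (\<lambda>s \<sigma>. fst (step (event_at L A B s) \<sigma>))
       (sorted_list_of_set ((L \<union> A \<union> B) \<inter> {0..<t})) \<eta>"

definition output_flux ::
    "real set \<Rightarrow> real set \<Rightarrow> real set \<Rightarrow> bool \<times> bool \<Rightarrow> real set" where
  "output_flux L A B \<eta> =
     {t \<in> L \<union> A \<union> B. snd (step (event_at L A B t) (occupancies_before L A B \<eta> t))}"

end

(*
  Merge the two bell processes into one Poisson process of rate 1/x + 1/y whose points carry
  independent marks, left with probability p and right with probability 1 - p. The output flux turns
  out to depend on the marks only through their descents, the places where a left bell is directly
  followed by a right bell. Cutting the marks after each descent gives blocks of i right bells, then
  j + 1 left bells, then one right bell, with weight ((1 - p)^i p) (p^j (1 - p)). Exchanging i and j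
  in every block therefore exchanges p and 1 - p but preserves the descents, and this is the coupling.
*)

theory Submission
  imports Defs
begin

section \<open>Marks and their descents\<close>

text \<open>The construction runs from blocks to marks: i.i.d. pairs of geometric variables are
  concatenated and the result is shown to be an i.i.d. mark sequence, so a decomposition of a given
  sequence, with its exceptional set of too few descents, never has to be made. The right bell
  completing a descent closes its block, hence what follows is a fresh sequence and cannot form a
  descent with it. Both copies ring at the same times and differ only in the kinds of bells. The
  comparison of fluxes is therefore a statement about single paths, and one probability space serves
  every \<open>L\<close> and every admissible \<eta>. The probabilistic work lies in showing that
  left and right bells form independent Poisson processes. Their joint counts on a finite grid are
  computed from exponential gaps; with \<open>l = 1 / x + 1 / y\<close>, the splitting of
  \<open>exp (- l * d)\<close> into factors with rates \<open>l * p\<close> and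
  \<open>l * (1 - p)\<close> is the source of the independence.\<close>

text \<open>True marks a left bell. Every block ends with its only descent.\<close>

definition block :: "nat \<times> nat \<Rightarrow> bool list" where
  "block ij = replicate (fst ij) False @ replicate (Suc (snd ij)) True @ [False]"

definition marks :: "(nat \<times> nat) stream \<Rightarrow> bool stream" where
  "marks bl = flat (smap block bl)"

lemma block_neq_Nil [simp]: "block ij \<noteq> []"
  by (simp add: block_def)

lemma length_block [simp]: "length (block ij) = fst ij + snd ij + 2"
  by (simp add: block_def)

lemma nth_block: "k < fst ij + snd ij + 2 \<Longrightarrow> block ij ! k \<longleftrightarrow> fst ij \<le> k \<and> k \<le> fst ij + snd ij"
  by (auto simp: block_def nth_append nth_Cons')

lemma marks_Stream [simp]: "marks (ij ## bl) = block ij @- marks bl"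
  by (simp add: marks_def)

lemma marks_Stream_snth:
  "marks (ij ## bl) !! k \<longleftrightarrow>
     (if k < fst ij + snd ij + 2 then fst ij \<le> k \<and> k \<le> fst ij + snd ij
      else marks bl !! (k - (fst ij + snd ij + 2)))"
  by (cases "k < length (block ij)") (auto simp: shift_snth_less shift_snth_ge nth_block)

text \<open>Within a block \<open>(i, j)\<close> the only descent is at index \<open>i + j\<close>,
  the last left bell, and the block has length \<open>i + j + 2\<close>. Both numbers are symmetric
  in \<open>i\<close> and \<open>j\<close>. An index beyond the first block is reduced by that
  length, whence the strong induction.\<close>

lemma marks_swap_descents:
  "marks (smap prod.swap bl) !! k \<and> \<not> marks (smap prod.swap bl) !! Suc k \<longleftrightarrow>
   marks bl !! k \<and> \<not> marks bl !! Suc k"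
proof (induction k arbitrary: bl rule: less_induct)
  case (less k)
  obtain i j bl' where bl: "bl = (i, j) ## bl'"
    by (metis stream.exhaust surj_pair)
  show ?case
  proof (cases "k < i + j + 2")
    case True
    then show ?thesis
      by (auto simp: bl marks_Stream_snth simp del: marks_Stream snth.simps)
  next
    case False
    then have "Suc k - (i + j + 2) = Suc (k - (i + j + 2))"
      by simp
    with False less.IH[of "k - (i + j + 2)" bl'] show ?thesis
      by (simp add: bl marks_Stream_snth add.commute[of j i] del: marks_Stream snth.simps)
  qed
qed

section \<open>The output flux depends only on the descents\<close>

text \<open>Provides the recursion for \<open>occupancies_before\<close>: the last event before a
  time acts on the occupancies just before that event.\<close>

lemma fold_sorted_list_of_set_Max:
  assumes "finite F" and "F \<noteq> {}"
  shows "fold f (sorted_list_of_set F) \<eta> =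
    f (Max F) (fold f (sorted_list_of_set {s \<in> F. s < Max F}) \<eta>)"
proof -
  have F: "F = insert (Max F) {s \<in> F. s < Max F}"
    using Max_in[OF assms] Max_ge[OF assms(1)] by (auto simp: order_less_le)
  then have "card F = Suc (card {s \<in> F. s < Max F})"
    using assms(1) by (metis (no_types, lifting) card_insert_disjoint finite_insert mem_Collect_eq less_irrefl)
  with F assms have "sorted_list_of_set {s \<in> F. s < Max F} @ [Max F] = sorted_list_of_set F"
    by (intro sorted_list_of_set_unique[THEN iffD1, symmetric])
      (auto simp: sorted_wrt_append)
  then show ?thesis
    by (metis (no_types, lifting) fold_simps(1) fold_append fold_simps(2) comp_apply)
qed

text \<open>
  Two copies of the two-site system just before bell \<open>n\<close>, with marks \<open>m\<close> and \<open>m'\<close> (true for a left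
  bell) that have the same descents, a descent being a left bell directly followed by a right bell.
  A lone particle leaves at the first descent from bell \<open>n\<close> on if it is on the left, and from bell
  \<open>n - 1\<close> on if it is on the right: it is on the right only because bell \<open>n - 1\<close> was a left one, which
  is why the initial state \<open>(0, 1)\<close> is excluded. So copies with one particle each leave together
  unless they are in different states and there is a descent at \<open>n - 1\<close>.
\<close>

definition matched ::
    "(nat \<Rightarrow> bool) \<Rightarrow> (nat \<Rightarrow> bool) \<Rightarrow> nat \<Rightarrow> bool \<times> bool \<Rightarrow> bool \<times> bool \<Rightarrow> bool" where
  "matched m m' n \<sigma> \<sigma>' \<longleftrightarrow>
     (\<sigma> = \<sigma>' \<or> (\<sigma>, \<sigma>') \<in> {((True, False), (False, True)), ((False, True), (True, False))} \<and> \<not> (m (n - 1) \<and> \<not> m n)) \<and>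
     (\<sigma> = (False, True) \<longrightarrow> 0 < n \<and> m (n - 1)) \<and> (\<sigma>' = (False, True) \<longrightarrow> 0 < n \<and> m' (n - 1))"

text \<open>An arrival turns both \<open>(1, 0)\<close> and \<open>(0, 1)\<close> into
  \<open>(1, 1)\<close> without output, so differing copies coalesce. It never produces
  \<open>(0, 1)\<close>, so no condition on marks has to be re-established.\<close>

lemma matched_Arrival:
  assumes "matched m m' n \<sigma> \<sigma>'"
  shows "matched m m' n (fst (step Arrival \<sigma>)) (fst (step Arrival \<sigma>'))"
    and "snd (step Arrival \<sigma>) = snd (step Arrival \<sigma>')"
proof -
  obtain a b a' b' where [simp]: "\<sigma> = (a, b)" "\<sigma>' = (a', b')"
    by fastforce
  show "matched m m' n (fst (step Arrival \<sigma>)) (fst (step Arrival \<sigma>'))"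
    and "snd (step Arrival \<sigma>) = snd (step Arrival \<sigma>')"
    using assms by (cases a; cases b; cases a'; cases b'; auto simp: matched_def)+
qed

text \<open>Equality of descents is used at two indices. At \<open>n - 1\<close> it decides the next
  bell of a copy with its particle on the right: two copies in \<open>(0, 1)\<close> receive the
  same bell, and if the copies differ, the one in \<open>(0, 1)\<close> receives a left bell and
  stays. At \<open>n\<close> it gives the absence of a descent when equal states are separated by
  different bells: one of the two bells is a right bell, so neither sequence descends there.\<close>

lemma matched_bell:
  fixes m m' :: "nat \<Rightarrow> bool"
  defines "e \<equiv> \<lambda>b. if b then Bell_left else Bell_right"
  assumes "matched m m' n \<sigma> \<sigma>'"
    and "\<And>k. m k \<and> \<not> m (Suc k) \<longleftrightarrow> m' k \<and> \<not> m' (Suc k)"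
  shows "matched m m' (Suc n) (fst (step (e (m n)) \<sigma>)) (fst (step (e (m' n)) \<sigma>'))"
    and "snd (step (e (m n)) \<sigma>) = snd (step (e (m' n)) \<sigma>')"
proof -
  from assms(2) consider
      "\<sigma> = (False, False)" "\<sigma>' = (False, False)"
    | "\<sigma> = (True, True)" "\<sigma>' = (True, True)"
    | "\<sigma> = (True, False)" "\<sigma>' = (True, False)"
    | "\<sigma> = (False, True)" "\<sigma>' = (False, True)" "0 < n" "m (n - 1)" "m' (n - 1)"
    | "\<sigma> = (True, False)" "\<sigma>' = (False, True)" "0 < n" "m' (n - 1)" "\<not> (m (n - 1) \<and> \<not> m n)"
    | "\<sigma> = (False, True)" "\<sigma>' = (True, False)" "0 < n" "m (n - 1)" "m n"
    by (cases \<sigma>; cases \<sigma>') (auto simp: matched_def)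
  then have "matched m m' (Suc n) (fst (step (e (m n)) \<sigma>)) (fst (step (e (m' n)) \<sigma>')) \<and>
      snd (step (e (m n)) \<sigma>) = snd (step (e (m' n)) \<sigma>')"
    using assms(3)[of n] assms(3)[of "n - 1"]
    by cases (cases "m n"; cases "m' n"; simp add: matched_def e_def)+
  then show "matched m m' (Suc n) (fst (step (e (m n)) \<sigma>)) (fst (step (e (m' n)) \<sigma>'))"
    and "snd (step (e (m n)) \<sigma>) = snd (step (e (m' n)) \<sigma>')"
    by blast+
qed

text \<open>Both systems have the same event times \<open>L \<union> range S\<close>, so
  \<open>matched\<close> can be propagated from event to event. Its index is the number of bells
  before the current time, and it forces equal outputs at every event.\<close>

lemma output_flux_cong_descents:
  fixes S :: "nat \<Rightarrow> real" and m m' :: "nat \<Rightarrow> bool"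
  assumes S: "strict_mono S" "\<And>n. 0 \<le> S n" "\<And>t. finite {n. S n < t}"
    and L: "L \<in> locally_finite_points" "L \<inter> range S = {}"
    and descents: "\<And>k. m k \<and> \<not> m (Suc k) \<longleftrightarrow> m' k \<and> \<not> m' (Suc k)"
    and \<eta>: "\<eta> \<in> {(False, False), (True, True), (True, False)}"
  shows "output_flux L (S ` {n. m n}) (S ` {n. \<not> m n}) \<eta> =
    output_flux L (S ` {n. m' n}) (S ` {n. \<not> m' n}) \<eta>"
proof -
  define V where "V = L \<union> range S"
  have V: "L \<union> S ` {n. m n} \<union> S ` {n. \<not> m n} = V" for m
    by (auto simp: V_def)
  have inj: "S i = S j \<longleftrightarrow> i = j" and less: "S i < S j \<longleftrightarrow> i < j" for i j
    using S(1) by (auto simp: strict_mono_eq strict_mono_less)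
  \<comment> \<open>Since \<open>L\<close> avoids all bells and \<open>S\<close> is injective, there
    are no simultaneous events and the mark of a bell is recovered from its time by
    \<open>inv S\<close>.\<close>
  have event: "event_at L (S ` {n. m n}) (S ` {n. \<not> m n}) s =
      (if s \<in> L then Arrival else if m (inv S s) then Bell_left else Bell_right)"
    if "s \<in> V" for s m
    using that strict_mono_imp_inj_on[OF S(1)] by (auto simp: event_at_def V_def inv_f_f inj)
  have fin: "finite (V \<inter> {0..<t})" for t
  proof (rule finite_subset)
    show "V \<inter> {0..<t} \<subseteq> L \<inter> {0..t} \<union> S ` {n. S n < t}"
      by (auto simp: V_def)
    show "finite (L \<inter> {0..t} \<union> S ` {n. S n < t})"
      using L S(3) by (auto simp: locally_finite_points_def)
  qed
  let ?occ = "\<lambda>m. occupancies_before L (S ` {n. m n}) (S ` {n. \<not> m n}) \<eta>"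
  have count_bell: "card {n. S n < S k} = k" for k
    by (simp add: less)
  \<comment> \<open>An arrival leaves the bell counter alone; a bell at \<open>s\<close> has index
    \<open>inv S s\<close>, which equals the number of earlier bells, and raises the counter by
    one.\<close>
  have step: "matched m m' (if s \<in> L then card {n. S n < s} else Suc (inv S s))
       (fst (step (event_at L (S ` {n. m n}) (S ` {n. \<not> m n}) s) (?occ m s)))
       (fst (step (event_at L (S ` {n. m' n}) (S ` {n. \<not> m' n}) s) (?occ m' s)))"
    and out: "snd (step (event_at L (S ` {n. m n}) (S ` {n. \<not> m n}) s) (?occ m s)) =
       snd (step (event_at L (S ` {n. m' n}) (S ` {n. \<not> m' n}) s) (?occ m' s))"
    if "s \<in> V" "matched m m' (card {n. S n < s}) (?occ m s) (?occ m' s)" for s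
  proof -
    have "card {n. S n < s} = inv S s" if "s \<notin> L"
      using that \<open>s \<in> V\<close> by (auto simp: V_def count_bell inv_f_f strict_mono_imp_inj_on[OF S(1)])
    then show "matched m m' (if s \<in> L then card {n. S n < s} else Suc (inv S s))
       (fst (step (event_at L (S ` {n. m n}) (S ` {n. \<not> m n}) s) (?occ m s)))
       (fst (step (event_at L (S ` {n. m' n}) (S ` {n. \<not> m' n}) s) (?occ m' s)))"
      and "snd (step (event_at L (S ` {n. m n}) (S ` {n. \<not> m n}) s) (?occ m s)) =
       snd (step (event_at L (S ` {n. m' n}) (S ` {n. \<not> m' n}) s) (?occ m' s))"
      unfolding event[OF that(1)]
      using matched_Arrival[OF that(2)] matched_bell[OF that(2) descents]
      by (cases "s \<in> L"; simp only: if_True if_False simp_thms)+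
  qed
  have matched: "matched m m' (card {n. S n < t}) (?occ m t) (?occ m' t)" for t
  \<comment> \<open>Induction on the number of events before \<open>t\<close>, which is finite; the
    last of them leads back to a time with fewer.\<close>
  proof (induction "card (V \<inter> {0..<t})" arbitrary: t rule: less_induct)
    case less
    show ?case
    proof (cases "V \<inter> {0..<t} = {}")
      case True
      then have no_bells: "{n. S n < t} = {}"
        using S(2) by (force simp: V_def disjoint_iff)
      \<comment> \<open>No bell has rung yet, so \<open>matched\<close> holds at index 0 only for
        states other than \<open>(0, 1)\<close>; this is where the restriction on \<eta>
        enters.\<close>
      show ?thesis
        using \<eta> unfolding no_bells occupancies_before_def V True by (auto simp: matched_def)
    next
      case False
      define s where "s = Max (V \<inter> {0..<t})"
      have s: "s \<in> V" "0 \<le> s" "s < t" and s_max: "\<And>v. v \<in> V \<Longrightarrow> 0 \<le> v \<Longrightarrow> v < t \<Longrightarrow> v \<le> s"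
        using Max_in[OF fin False] Max_ge[OF fin] by (auto simp: s_def)
      have eq: "{v \<in> V \<inter> {0..<t}. v < s} = V \<inter> {0..<s}"
        using s by auto
      have "card (V \<inter> {0..<s}) < card (V \<inter> {0..<t})"
        using s by (intro psubset_card_mono fin) auto
      note step = step[OF s(1) less.hyps[OF this]]
      have occ: "?occ m t = fst (step (event_at L (S ` {n. m n}) (S ` {n. \<not> m n}) s) (?occ m s))" for m
        unfolding occupancies_before_def V fold_sorted_list_of_set_Max[OF fin False] s_def[symmetric] eq ..
      have "card {n. S n < t} = (if s \<in> L then card {n. S n < s} else Suc (inv S s))"
      proof (cases "s \<in> L")
        case True
        have "S n < t \<longleftrightarrow> S n < s" for n
          using s_max[of "S n"] s True L(2) S(2) by (force simp: V_def order_less_le)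
        with True show ?thesis
          by simp
      next
        case False
        then obtain k where k: "s = S k"
          using s by (auto simp: V_def)
        have "S n < t \<longleftrightarrow> S n \<le> S k" for n
          using s_max[of "S n"] s S(2)[of n] by (auto simp: V_def k)
        then have "S n < t \<longleftrightarrow> n \<le> k" for n
          using S(1) by (simp add: strict_mono_less_eq)
        then have "{n. S n < t} = {..k}"
          by auto
        with False show ?thesis
          by (simp add: k inv_f_f strict_mono_imp_inj_on[OF S(1)])
      qed
      with step show ?thesis
        unfolding occ by simp
    qed
  qed
  show ?thesis
    unfolding output_flux_def V using out matched by auto
qed

section \<open>The law of the marks\<close>

abbreviation coins :: "real \<Rightarrow> bool stream measure" where
  "coins p \<equiv> stream_space (measure_pmf (bernoulli_pmf p))"

text \<open>\<open>geometric_pmf q\<close> counts failures before the first success of probability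
  \<open>q\<close>. The right bells before the first left bell thus have parameter \<open>p\<close>,
  and the further left bells before the next right bell have parameter \<open>1 - p\<close>.\<close>

abbreviation block_lengths :: "real \<Rightarrow> (nat \<times> nat) pmf" where
  "block_lengths p \<equiv> pair_pmf (geometric_pmf p) (geometric_pmf (1 - p))"

abbreviation blocks :: "real \<Rightarrow> (nat \<times> nat) stream measure" where
  "blocks p \<equiv> stream_space (measure_pmf (block_lengths p))"

text \<open>Conditioning on the first trial. Applied to a block length, it peels a single mark off
  the block.\<close>

lemma nn_integral_geometric_pmf:
  assumes "0 < p" "p \<le> 1"
  shows "(\<integral>\<^sup>+n. f n \<partial>geometric_pmf p) = ennreal p * f 0 + ennreal (1 - p) * (\<integral>\<^sup>+n. f (Suc n) \<partial>geometric_pmf p)"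
  using assms by (subst geometric_bind_pmf_unfold) (auto simp: mult.commute)

lemma sets_stream_space_pmf [measurable_cong]:
  "sets (stream_space (measure_pmf q)) = sets (stream_space (count_space UNIV))"
  by (rule sets_stream_space_cong) simp

lemma space_stream_space_pmf [simp]: "space (stream_space (measure_pmf q)) = UNIV"
  by (simp add: space_stream_space)

text \<open>The first block takes countably many values. For each of them the mark is either
  constant or a mark of smaller index in the remaining stream, because blocks are nonempty.\<close>

lemma marks_snth_measurable:
  "(\<lambda>bl. marks bl !! k) \<in> stream_space (count_space UNIV) \<rightarrow>\<^sub>M count_space UNIV"
proof (induction k rule: less_induct)
  case (less k)
  let ?f = "\<lambda>(i, j) bl. if k < i + j + 2 then i \<le> k \<and> k \<le> i + j
    else marks (stl bl) !! (k - (i + j + 2))"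
  have eq: "marks bl !! k \<longleftrightarrow> ?f (shd bl) bl" for bl
  proof -
    obtain i j bl' where "bl = (i, j) ## bl'"
      by (metis stream.exhaust surj_pair)
    then show ?thesis
      by (simp add: marks_Stream_snth del: marks_Stream)
  qed
  have "?f ij \<in> stream_space (count_space UNIV) \<rightarrow>\<^sub>M count_space UNIV" for ij
  proof (cases "k < fst ij + snd ij + 2")
    case False
    then have "(\<lambda>bl. marks (stl bl) !! (k - (fst ij + snd ij + 2))) \<in>
        stream_space (count_space UNIV) \<rightarrow>\<^sub>M count_space UNIV"
      by (intro measurable_compose[OF measurable_stl less.IH]) simp
    with False show ?thesis
      by (simp only: case_prod_unfold if_False)
  qed (simp add: case_prod_unfold)
  then show ?case
    unfolding eq by (rule measurable_compose_countable) measurable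
qed

lemma marks_measurable:
  "marks \<in> stream_space (count_space UNIV) \<rightarrow>\<^sub>M stream_space (count_space UNIV)"
  by (rule measurable_stream_space2) (rule marks_snth_measurable)

lemma Collect_sstart_measurable:
  assumes "g \<in> stream_space (measure_pmf q) \<rightarrow>\<^sub>M stream_space (count_space UNIV)"
  shows "{s. g s \<in> sstart UNIV xs} \<in> sets (stream_space (measure_pmf q))"
  using measurable_sets[OF assms sets_sstart[of UNIV xs]] by (simp add: vimage_def)

context
  notes marks_measurable [measurable]
begin

text \<open>Reading marks one at a time visits two situations: no left bell of the current block
  read yet, or at least one read. The two conjuncts say that the future has the coin law in either
  situation, and the induction needs both: a left bell leads from the first to the second, a right
  bell in the second starts a new block, and otherwise memorylessness of the geometric law keeps the
  situation.\<close>

lemma emeasure_marks_sstart: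
  assumes p: "0 < p" "p < 1"
  defines "w b \<equiv> ennreal (if b then p else 1 - p)"
  shows "emeasure (blocks p) {bl. marks bl \<in> sstart UNIV bs} = (\<Prod>b\<leftarrow>bs. w b) \<and>
    (\<integral>\<^sup>+j. emeasure (blocks p) {bl. replicate j True @- False ## marks bl \<in> sstart UNIV bs}
      \<partial>geometric_pmf (1 - p)) = (\<Prod>b\<leftarrow>bs. w b)"
proof (induction bs)
  case Nil
  show ?case
    using prob_space.emeasure_space_1[OF prob_space.prob_space_stream_space[OF prob_space_measure_pmf], of "block_lengths p"]
    by simp
next
  case (Cons b bs)
  let ?P = "\<lambda>f bs. emeasure (blocks p) {bl. f (marks bl) \<in> sstart UNIV bs}"
  let ?a = "\<lambda>j s. replicate j True @- False ## s"
  have P: "?P (\<lambda>s. s) bs = (\<integral>\<^sup>+i. \<integral>\<^sup>+j. ?P (\<lambda>s. replicate i False @- True ## ?a j s) bs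
      \<partial>geometric_pmf (1 - p) \<partial>geometric_pmf p)" for bs
    by (subst prob_space.emeasure_stream_space[OF prob_space_measure_pmf])
      (auto simp: nn_integral_pair_pmf' block_def intro!: Collect_sstart_measurable)
  have "?P (\<lambda>s. s) (b # bs) =
      ennreal p * (\<integral>\<^sup>+j. ?P (\<lambda>s. True ## ?a j s) (b # bs) \<partial>geometric_pmf (1 - p)) +
      ennreal (1 - p) * (\<integral>\<^sup>+i. \<integral>\<^sup>+j. ?P (\<lambda>s. False ## replicate i False @- True ## ?a j s) (b # bs)
        \<partial>geometric_pmf (1 - p) \<partial>geometric_pmf p)"
    using p by (subst P, subst nn_integral_geometric_pmf) auto
  also have "\<dots> = w b * (\<Prod>b\<leftarrow>bs. w b)"
    using Cons P[of bs] by (cases b) (simp_all add: w_def)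
  finally have P_Cons: "?P (\<lambda>s. s) (b # bs) = w b * (\<Prod>b\<leftarrow>bs. w b)" .
  have "(\<integral>\<^sup>+j. ?P (?a j) (b # bs) \<partial>geometric_pmf (1 - p)) =
      ennreal (1 - p) * ?P (\<lambda>s. False ## s) (b # bs) +
      ennreal p * (\<integral>\<^sup>+j. ?P (\<lambda>s. True ## ?a j s) (b # bs) \<partial>geometric_pmf (1 - p))"
    using p by (subst nn_integral_geometric_pmf) auto
  also have "\<dots> = w b * (\<Prod>b\<leftarrow>bs. w b)"
    using Cons by (cases b) (simp_all add: w_def)
  finally show ?case
    using P_Cons by simp
qed

end

text \<open>With \<open>f\<close> the identity this is also the cylinder formula for an i.i.d.
  stream. Cylinders determine the law of a stream over a countable alphabet, which is how all laws
  of streams below are compared.\<close>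

lemma emeasure_smap_sstart:
  fixes f :: "'a \<Rightarrow> 'b"
  shows "emeasure (stream_space (measure_pmf q)) {s. smap f s \<in> sstart UNIV xs} =
    (\<Prod>x\<leftarrow>xs. ennreal (pmf (map_pmf f q) x))"
proof (induction xs)
  case Nil
  show ?case
    using prob_space.emeasure_space_1[OF prob_space.prob_space_stream_space[OF prob_space_measure_pmf], of q]
    by simp
next
  case (Cons x xs)
  have "emeasure (stream_space (measure_pmf q)) {s. smap f s \<in> sstart UNIV (x # xs)} =
      (\<integral>\<^sup>+y. indicator (f -` {x}) y * emeasure (stream_space (measure_pmf q)) {s. smap f s \<in> sstart UNIV xs} \<partial>q)"
  proof (subst prob_space.emeasure_stream_space[OF prob_space_measure_pmf])
    show "{s. smap f s \<in> sstart UNIV (x # xs)} \<in> sets (stream_space (measure_pmf q))"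
      by (rule Collect_sstart_measurable) measurable
  qed (intro nn_integral_cong, simp add: indicator_def)
  then show ?case
    by (simp add: nn_integral_multc Cons pmf_map measure_pmf.emeasure_eq_measure)
qed

lemma distr_smap_stream_space_pmf:
  fixes f :: "'a \<Rightarrow> 'b::countable"
  shows "distr (stream_space (measure_pmf q)) (stream_space (count_space UNIV)) (smap f) = stream_space (measure_pmf (map_pmf f q))"
proof (rule stream_space_eq_sstart[where S = UNIV])
  show "prob_space (distr (stream_space (measure_pmf q)) (stream_space (count_space UNIV)) (smap f))"
    by (intro prob_space.prob_space_distr prob_space.prob_space_stream_space prob_space_measure_pmf)
      measurable
  show "prob_space (stream_space (measure_pmf (map_pmf f q)))"
    by (intro prob_space.prob_space_stream_space prob_space_measure_pmf)
  show "emeasure (distr (stream_space (measure_pmf q)) (stream_space (count_space UNIV)) (smap f)) (sstart UNIV xs) =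
      emeasure (stream_space (measure_pmf (map_pmf f q))) (sstart UNIV xs)" for xs
    using emeasure_smap_sstart[of q f xs] emeasure_smap_sstart[of "map_pmf f q" "\<lambda>x. x" xs]
    by (subst emeasure_distr) (auto simp: vimage_def stream.map_ident)
qed (auto simp: streams_UNIV sets_stream_space_pmf)

lemma distr_marks_blocks:
  assumes p: "0 < p" "p < 1"
  shows "distr (blocks p) (coins p) marks = coins p"
proof (rule stream_space_eq_sstart[where S = UNIV])
  note marks_measurable [measurable]
  show "prob_space (distr (blocks p) (coins p) marks)"
    by (intro prob_space.prob_space_distr prob_space.prob_space_stream_space[OF prob_space_measure_pmf]) measurable
  show "prob_space (coins p)"
    by (rule prob_space.prob_space_stream_space[OF prob_space_measure_pmf])
  fix bs :: "bool list"
  have "emeasure (coins p) (sstart UNIV bs) = (\<Prod>b\<leftarrow>bs. ennreal (if b then p else 1 - p))"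
    using emeasure_smap_sstart[of "bernoulli_pmf p" "\<lambda>x. x" bs] p
    by (simp add: stream.map_ident if_distrib) (auto intro!: arg_cong[where f = prod_list])
  then show "emeasure (distr (blocks p) (coins p) marks) (sstart UNIV bs) = emeasure (coins p) (sstart UNIV bs)"
    using emeasure_marks_sstart[OF p, of bs]
    using marks_measurable
    by (subst emeasure_distr) (auto simp: vimage_def cong: measurable_cong_sets)
qed (auto simp: streams_UNIV sets_stream_space_pmf)

text \<open>The two components of a block are independent with parameters \<open>p\<close> and
  \<open>1 - p\<close>, so exchanging them replaces \<open>p\<close> by
  \<open>1 - p\<close>.\<close>

lemma distr_swap_blocks:
  "distr (blocks p) (stream_space (count_space UNIV)) (smap prod.swap) = blocks (1 - p)"
proof -
  have "map_pmf prod.swap (block_lengths p) = block_lengths (1 - p)"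
    by (subst (2) pair_commute_pmf) (simp add: prod.swap_def[abs_def] case_prod_unfold)
  then show ?thesis
    by (simp add: distr_smap_stream_space_pmf)
qed

section \<open>Poisson processes with independent marks\<close>

abbreviation gaps :: "real \<Rightarrow> real stream measure" where
  "gaps l \<equiv> stream_space (density lborel (exponential_density l))"

lemma sets_gaps [measurable_cong]: "sets (gaps l) = sets (stream_space borel)"
  by (rule sets_stream_space_cong) simp

lemma space_gaps [simp]: "space (gaps l) = UNIV"
  by (simp add: space_stream_space)

section \<open>Bell times and their divergence\<close>

definition bell_time :: "real stream \<Rightarrow> nat \<Rightarrow> real" where
  "bell_time E n = (\<Sum>i\<le>n. E !! i)"

lemma bell_time_Stream_0: "bell_time (e ## E) 0 = e"
  and bell_time_Stream_Suc: "bell_time (e ## E) (Suc n) = e + bell_time E n"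
  by (simp_all add: bell_time_def sum.atMost_Suc_shift del: sum.atMost_Suc)

lemma bell_time_measurable [measurable]: "(\<lambda>E. bell_time E n) \<in> borel_measurable (stream_space borel)"
  unfolding bell_time_def by measurable

text \<open>The second condition asks for infinitely many gaps above 1. It is a coordinatewise,
  visibly measurable sufficient condition for the bell times to tend to infinity.\<close>

definition regular :: "real stream \<Rightarrow> bool" where
  "regular E \<longleftrightarrow> (\<forall>n. 0 < E !! n) \<and> (\<forall>N. \<exists>n. 1 < E !! (N + n))"

lemma regular_measurable [measurable]: "Measurable.pred (stream_space borel) regular"
  unfolding regular_def by measurable

lemma all_nat_split: "(\<forall>n. P n) \<longleftrightarrow> P 0 \<and> (\<forall>n. P (Suc n))"
  by (metis not0_implies_Suc)

lemma regular_Stream: "regular (e ## E) \<longleftrightarrow> 0 < e \<and> regular E"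
proof -
  have "(\<forall>N. \<exists>n. 1 < (e ## E) !! (N + n)) \<longleftrightarrow> (\<forall>N. \<exists>n. 1 < E !! (N + n))"
  proof (intro iffI allI)
    fix N
    assume *: "\<forall>N. \<exists>n. 1 < (e ## E) !! (N + n)"
    from *[rule_format, of "Suc N"] show "\<exists>n. 1 < E !! (N + n)"
      by simp
  next
    fix N
    assume *: "\<forall>N. \<exists>n. 1 < E !! (N + n)"
    from *[rule_format, of N] obtain n where "1 < E !! (N + n)" ..
    then have "1 < (e ## E) !! (N + Suc n)"
      by simp
    then show "\<exists>n. 1 < (e ## E) !! (N + n)" ..
  qed
  moreover have "(\<forall>n. 0 < (e ## E) !! n) \<longleftrightarrow> 0 < e \<and> (\<forall>n. 0 < E !! n)"
    by (subst all_nat_split) simp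
  ultimately show ?thesis
    by (simp add: regular_def)
qed

text \<open>If infinitely many bell times stayed below \<open>t\<close>, all partial sums of the
  positive gaps would be bounded, so the gaps would tend to 0, against infinitely many of them
  exceeding 1.\<close>

lemma
  assumes "regular E"
  shows strict_mono_bell_time: "strict_mono (bell_time E)"
    and bell_time_pos: "0 < bell_time E n"
    and finite_bell_time_less: "finite {n. bell_time E n < t}"
proof -
  have pos: "0 < E !! n" for n
    using assms by (simp add: regular_def)
  then show "0 < bell_time E n"
    unfolding bell_time_def by (intro sum_pos) auto
  show mono: "strict_mono (bell_time E)"
    using pos by (intro strict_mono_Suc_iff[THEN iffD2]) (simp add: bell_time_def del: snth.simps)
  show "finite {n. bell_time E n < t}"
  proof (rule ccontr)
    assume "infinite {n. bell_time E n < t}"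
    then have "\<exists>n'\<ge>n. bell_time E n' < t" for n
      by (auto simp: infinite_nat_iff_unbounded_le)
    then have "bell_time E n \<le> t" for n
      using strict_mono_mono[OF mono, THEN monoD, of n] by (meson less_imp_le order_trans)
    moreover have "(\<Sum>i<n. E !! i) \<le> bell_time E n" for n
      unfolding bell_time_def using pos by (intro sum_mono2) (auto intro: less_imp_le)
    ultimately have "summable (\<lambda>i. E !! i)"
      using pos by (intro bounded_imp_summable[where B = t]) (auto intro: less_imp_le order_trans simp: lessThan_Suc_atMost[symmetric] bell_time_def)
    then have "eventually (\<lambda>n. E !! n < 1) sequentially"
      by (auto dest!: summable_LIMSEQ_zero order_tendstoD(2)[where a = 1])
    then obtain N where "\<And>n. n \<ge> N \<Longrightarrow> E !! n < 1"
      by (auto simp: eventually_sequentially)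
    then show False
      using assms unfolding regular_def by (meson le_add1 less_asym)
  qed
qed

text \<open>Splitting off the first gap shows that the probability \<open>q\<close> of all gaps
  being at most 1 satisfies \<open>q = (1 - exp (- l)) * q\<close>, so \<open>q = 0\<close>. The
  same holds for every tail, by discarding gaps one at a time.\<close>

lemma AE_regular:
  assumes "0 < l"
  shows "AE E in gaps l. regular E"
proof -
  let ?D = "density lborel (exponential_density l)"
  interpret D: prob_space ?D
    using assms by (rule prob_space_exponential_density)
  interpret S: prob_space "gaps l"
    by (rule D.prob_space_stream_space)
  have "AE e in ?D. 0 \<le> e"
    by (auto simp: AE_density exponential_density_def)
  moreover have "AE e in ?D. e \<noteq> 0"
    using AE_lborel_singleton[of 0] by (auto simp: AE_density elim!: eventually_mono)
  ultimately have "AE e in ?D. 0 < e"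
    by eventually_elim simp
  then have pos: "AE E in gaps l. stream_all (\<lambda>e. 0 < e) E"
    by (intro D.AE_stream_all) auto
  have "distributed ?D lborel (\<lambda>e. e) (exponential_density l)"
    unfolding distributed_def by (simp add: distr_id2)
  then have le_1: "D.prob {e \<in> space ?D. e \<le> 1} = 1 - exp (- l)"
    using D.exponential_distributedD_le[of "\<lambda>e. e" l 1] assms by simp
  let ?X = "{E \<in> space (gaps l). \<forall>n. E !! n \<le> 1}"
  have "emeasure (gaps l) ?X = (\<integral>\<^sup>+e. indicator {..1} e * emeasure (gaps l) ?X \<partial>?D)"
  proof (subst D.emeasure_stream_space)
    have "{E \<in> space (gaps l). e ## E \<in> ?X} = (if e \<le> 1 then ?X else {})" for e
      by (subst mem_Collect_eq, subst all_nat_split) auto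
    then show "(\<integral>\<^sup>+e. emeasure (gaps l) {E \<in> space (gaps l). e ## E \<in> ?X} \<partial>?D) =
        (\<integral>\<^sup>+e. indicator {..1} e * emeasure (gaps l) ?X \<partial>?D)"
      by (auto intro!: nn_integral_cong simp: indicator_def)
  qed measurable
  also have "\<dots> = emeasure ?D {..1} * emeasure (gaps l) ?X"
    by (subst nn_integral_multc) auto
  also have "emeasure ?D {..1} = ennreal (1 - exp (- l))"
    using le_1 by (simp add: D.emeasure_eq_measure atMost_def)
  finally have "S.prob ?X = (1 - exp (- l)) * S.prob ?X"
    using assms by (simp add: S.emeasure_eq_measure ennreal_mult'' flip: ennreal_mult'')
  then have "S.prob ?X = 0"
    by (simp add: algebra_simps)
  then have X: "AE E in gaps l. \<not> (\<forall>n. E !! n \<le> 1)"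
  proof (intro AE_I[where N = ?X])
    show "?X \<in> sets (gaps l)"
      by measurable
  qed (auto simp: S.emeasure_eq_measure)
  have "AE E in gaps l. \<not> (\<forall>n. E !! (N + n) \<le> 1)" for N
  proof (induction N)
    case (Suc N)
    have "Measurable.pred (gaps l) (\<lambda>E. \<not> (\<forall>n. E !! (Suc N + n) \<le> 1))"
      by measurable
    from D.AE_stream_space[OF this] Suc show ?case
      by simp
  qed (use X in simp)
  then have "AE E in gaps l. \<forall>N. \<not> (\<forall>n. E !! (N + n) \<le> 1)"
    by (simp add: AE_all_countable)
  with pos show ?thesis
    by eventually_elim (auto simp: regular_def not_le stream_all_def)
qed

section \<open>Prescribed counts over successive intervals\<close>

definition bell_count :: "real stream \<Rightarrow> bool stream \<Rightarrow> bool \<Rightarrow> real \<Rightarrow> real \<Rightarrow> nat" where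
  "bell_count E m c s t = card {n. m !! n = c \<and> s \<le> bell_time E n \<and> bell_time E n < t}"

text \<open>Each entry holds the length of an interval and its numbers of left and right bells.
  Lengths are stored instead of end points because restarting at a first bell in the head interval
  then changes only the head entry.\<close>

fun grid_counts :: "real \<Rightarrow> (real \<times> nat \<times> nat) list \<Rightarrow> real stream \<Rightarrow> bool stream \<Rightarrow> bool" where
  "grid_counts s [] E m \<longleftrightarrow> True"
| "grid_counts s ((d, a, b) # xs) E m \<longleftrightarrow>
     bell_count E m True s (s + d) = a \<and> bell_count E m False s (s + d) = b \<and> grid_counts (s + d) xs E m"

lemma bell_count_measurable [measurable]:
  "(\<lambda>\<omega>. bell_count (fst \<omega>) (snd \<omega>) c s t) \<in>
     stream_space borel \<Otimes>\<^sub>M stream_space (count_space UNIV) \<rightarrow>\<^sub>M count_space UNIV"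
proof -
  have [measurable]: "Measurable.pred (stream_space borel \<Otimes>\<^sub>M stream_space (count_space UNIV))
      (\<lambda>\<omega>. snd \<omega> !! n = c)" for n
    by measurable
  have [measurable]: "Measurable.pred (stream_space borel \<Otimes>\<^sub>M stream_space (count_space UNIV))
      (\<lambda>\<omega>. s \<le> bell_time (fst \<omega>) n \<and> bell_time (fst \<omega>) n < t)" for n
    by measurable
  show ?thesis
    unfolding bell_count_def by measurable
qed

lemma grid_counts_measurable [measurable]:
  "Measurable.pred (stream_space borel \<Otimes>\<^sub>M stream_space (count_space UNIV))
     (\<lambda>\<omega>. grid_counts s xs (fst \<omega>) (snd \<omega>))"
  by (induction s xs "undefined :: real stream" "undefined :: bool stream" rule: grid_counts.induct) auto

lemma bell_count_Stream_first:
  assumes "regular (e ## E)" and "e < d"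
  shows "bell_count (e ## E) (c ## m) c' 0 d = (if c' = c then 1 else 0) + bell_count E m c' 0 (d - e)"
proof -
  have E: "regular E" "0 < e"
    using assms(1) by (auto simp: regular_Stream)
  let ?N = "{n. m !! n = c' \<and> 0 \<le> bell_time E n \<and> bell_time E n < d - e}"
  have "{n. (c ## m) !! n = c' \<and> 0 \<le> bell_time (e ## E) n \<and> bell_time (e ## E) n < d} =
      {n. n = 0 \<and> c' = c} \<union> Suc ` ?N"
  proof (intro set_eqI)
    fix n
    show "n \<in> {n. (c ## m) !! n = c' \<and> 0 \<le> bell_time (e ## E) n \<and> bell_time (e ## E) n < d} \<longleftrightarrow>
        n \<in> {n. n = 0 \<and> c' = c} \<union> Suc ` ?N"
      using assms(2) E(2) bell_time_pos[OF E(1), of "n - 1"]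
      by (cases n) (auto simp: bell_time_Stream_0 bell_time_Stream_Suc)
  qed
  moreover have "finite ?N"
    by (rule finite_subset[OF _ finite_bell_time_less[OF E(1), of "d - e"]]) auto
  ultimately show ?thesis
    unfolding bell_count_def by (auto simp: card_image card_Un_disjoint)
qed

lemma bell_count_Stream_later:
  assumes "0 < s"
  shows "bell_count (e ## E) (c ## m) c' (e + s) (e + t) = bell_count E m c' s t"
proof -
  have "{n. (c ## m) !! n = c' \<and> e + s \<le> bell_time (e ## E) n \<and> bell_time (e ## E) n < e + t} =
      Suc ` {n. m !! n = c' \<and> s \<le> bell_time E n \<and> bell_time E n < t}"
  proof (intro set_eqI)
    fix n
    show "n \<in> {n. (c ## m) !! n = c' \<and> e + s \<le> bell_time (e ## E) n \<and> bell_time (e ## E) n < e + t} \<longleftrightarrow>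
        n \<in> Suc ` {n. m !! n = c' \<and> s \<le> bell_time E n \<and> bell_time E n < t}"
      using assms by (cases n) (auto simp: bell_time_Stream_0 bell_time_Stream_Suc)
  qed
  then show ?thesis
    by (simp add: bell_count_def card_image)
qed

lemma grid_counts_Stream:
  assumes "0 < s" and "\<forall>(d, a, b) \<in> set xs. 0 \<le> d"
  shows "grid_counts (e + s) xs (e ## E) (c ## m) \<longleftrightarrow> grid_counts s xs E m"
  using assms
proof (induction xs arbitrary: s)
  case (Cons x xs)
  obtain d a b where [simp]: "x = (d, a, b)"
    by (metis prod_cases3)
  have "grid_counts (e + (s + d)) xs (e ## E) (c ## m) \<longleftrightarrow> grid_counts (s + d) xs E m"
    using Cons.prems by (intro Cons.IH) auto
  then show ?case
    using Cons.prems bell_count_Stream_later[of s e E c m _ "s + d"] by (simp add: add.assoc)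
qed simp

text \<open>All bell times contain the first gap as a summand, so shortening it by \<open>r\<close>
  moves every bell by \<open>r\<close>.\<close>

lemma grid_counts_translate:
  "grid_counts (r + s) xs (e ## E) m \<longleftrightarrow> grid_counts s xs ((e - r) ## E) m"
proof -
  have "bell_time (e ## E) n = bell_time ((e - r) ## E) n + r" for n
    by (cases n) (simp_all add: bell_time_Stream_0 bell_time_Stream_Suc)
  then have "bell_count (e ## E) m c (r + s) (r + t) = bell_count ((e - r) ## E) m c s t" for c s t
    by (simp add: bell_count_def algebra_simps)
  then show ?thesis
    by (induction xs arbitrary: s) (auto simp: add.assoc)
qed

lemma grid_counts_late:
  assumes "regular (e ## E)" and "d \<le> e"
  shows "grid_counts 0 ((d, a, b) # xs) (e ## E) m \<longleftrightarrow>
    a = 0 \<and> b = 0 \<and> grid_counts 0 xs ((e - d) ## E) m"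
proof -
  have "e \<le> bell_time (e ## E) n" for n
    using strict_mono_mono[OF strict_mono_bell_time[OF assms(1)], THEN monoD, of 0 n]
    by (simp add: bell_time_Stream_0)
  then have "bell_count (e ## E) m c 0 d = 0" for c
    unfolding bell_count_def using assms(2) by (metis (mono_tags, lifting) card.empty Collect_empty_eq leD order_trans)
  then show ?thesis
    using grid_counts_translate[of d 0] by auto
qed

text \<open>The first bell lies in the head interval and before all later ones, so restarting at it
  shortens the head by \<open>e\<close>. The guards \<open>0 < a\<close> and \<open>0 < b\<close>
  protect the truncated subtractions.\<close>

lemma grid_counts_early:
  assumes "regular (e ## E)" and "e < d" and "\<forall>(d, a, b) \<in> set xs. 0 \<le> d"
  shows "grid_counts 0 ((d, a, b) # xs) (e ## E) (c ## m) \<longleftrightarrow>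
    (if c then 0 < a \<and> grid_counts 0 ((d - e, a - 1, b) # xs) E m
     else 0 < b \<and> grid_counts 0 ((d - e, a, b - 1) # xs) E m)"
  using grid_counts_Stream[of "d - e" xs e E c m] assms
  by (auto simp: bell_count_Stream_first)

section \<open>Joint law of the counts by conditioning on the first bell\<close>

lemma nn_integral_exponential_memoryless:
  assumes [measurable]: "f \<in> borel_measurable borel" and "0 \<le> d"
  shows "(\<integral>\<^sup>+e. indicator {d..} e * f (e - d) \<partial>density lborel (exponential_density l)) =
    ennreal (exp (- l * d)) * (\<integral>\<^sup>+e. f e \<partial>density lborel (exponential_density l))"
proof -
  have "(\<integral>\<^sup>+e. indicator {d..} e * f (e - d) \<partial>density lborel (exponential_density l)) =
      (\<integral>\<^sup>+e. ennreal (exponential_density l e) * (indicator {d..} e * f (e - d)) \<partial>lborel)"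
    by (subst nn_integral_density) auto
  \<comment> \<open>Translation by \<open>d\<close>; the density at \<open>d + e\<close> is then
    \<open>exp (- l * d)\<close> times the density at \<open>e\<close>.\<close>
  also have "\<dots> = (\<integral>\<^sup>+e. ennreal (exponential_density l (d + 1 * e)) *
      (indicator {d..} (d + 1 * e) * f (d + 1 * e - d)) \<partial>lborel)"
    by (subst nn_integral_real_affine[where c = 1 and t = d]) auto
  also have "\<dots> = (\<integral>\<^sup>+e. ennreal (exp (- l * d)) * (ennreal (exponential_density l e) * f e) \<partial>lborel)"
  proof (intro nn_integral_cong)
    fix e :: real
    have "exponential_density l (d + e) = exp (- l * d) * exponential_density l e" if "0 \<le> e"
    proof -
      have "exp (- (d + e) * l) = exp (- l * d) * exp (- e * l)"
        by (simp add: algebra_simps flip: exp_add)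
      then show ?thesis
        using that assms(2) by (simp add: exponential_density_def)
    qed
    then show "ennreal (exponential_density l (d + 1 * e)) *
        (indicator {d..} (d + 1 * e) * f (d + 1 * e - d)) =
        ennreal (exp (- l * d)) * (ennreal (exponential_density l e) * f e)"
      by (cases "0 \<le> e") (simp_all add: exponential_density_def ennreal_mult' mult.assoc)
  qed
  also have "\<dots> = ennreal (exp (- l * d)) * (\<integral>\<^sup>+e. f e \<partial>density lborel (exponential_density l))"
    by (subst nn_integral_cmult) (auto simp: nn_integral_density)
  finally show ?thesis .
qed

text \<open>The Poisson mass function as a plain real formula, which at parameter 0 becomes the
  point mass at 0 and so covers intervals of length 0.\<close>

definition poisson_weight :: "real \<Rightarrow> nat \<Rightarrow> real" where
  "poisson_weight r n = r ^ n / fact n * exp (- r)"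

lemma poisson_weight_nonneg: "0 \<le> r \<Longrightarrow> 0 \<le> poisson_weight r n"
  by (simp add: poisson_weight_def)

text \<open>The probability of the prescribed counts as an iterated integral with the gaps outside,
  so that the first gap can be split off before the marks are averaged.\<close>

definition grid_prob :: "real \<Rightarrow> real \<Rightarrow> (real \<times> nat \<times> nat) list \<Rightarrow> ennreal" where
  "grid_prob l p xs = (\<integral>\<^sup>+E. emeasure (coins p) {m. grid_counts 0 xs E m} \<partial>gaps l)"

lemma emeasure_grid_counts_measurable [measurable]:
  "(\<lambda>E. emeasure (coins p) {m. grid_counts 0 xs E m}) \<in> borel_measurable (stream_space borel)"
proof -
  interpret prob_space "coins p"
    by (rule prob_space.prob_space_stream_space[OF prob_space_measure_pmf])
  have "{\<omega> \<in> space (stream_space borel \<Otimes>\<^sub>M coins p). grid_counts 0 xs (fst \<omega>) (snd \<omega>)} \<in>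
      sets (stream_space borel \<Otimes>\<^sub>M coins p)"
    by measurable
  from measurable_emeasure_Pair[OF this] show ?thesis
    by (simp add: vimage_def space_pair_measure space_stream_space)
qed

lemma grid_counts_measurable_snd [measurable]:
  "Measurable.pred (stream_space (count_space UNIV)) (\<lambda>m. grid_counts s xs E m)"
proof -
  have "(\<lambda>m. (E, m)) \<in> stream_space (count_space UNIV) \<rightarrow>\<^sub>M
      stream_space borel \<Otimes>\<^sub>M stream_space (count_space UNIV)"
    by (intro measurable_Pair measurable_const) (auto simp: space_stream_space)
  from measurable_compose[OF this grid_counts_measurable] show ?thesis
    by simp
qed

lemma grid_counts_sets [simp]: "{m. grid_counts s xs E m} \<in> sets (coins p)"
  using predE[OF grid_counts_measurable_snd[of s xs E]]
  by (simp add: sets_stream_space_pmf space_stream_space)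

lemma grid_prob_Nil: "0 < l \<Longrightarrow> grid_prob l p [] = 1"
  using prob_space.emeasure_space_1[OF prob_space.prob_space_stream_space[OF prob_space_measure_pmf], of "bernoulli_pmf p"]
    prob_space.emeasure_space_1[OF prob_space.prob_space_stream_space[OF prob_space_exponential_density], of l]
  by (simp add: grid_prob_def)

lemma grid_prob_Stream:
  assumes "0 < l"
  shows "grid_prob l p xs = (\<integral>\<^sup>+e. \<integral>\<^sup>+E. emeasure (coins p) {m. grid_counts 0 xs (e ## E) m}
    \<partial>gaps l \<partial>density lborel (exponential_density l))"
  unfolding grid_prob_def
  by (rule prob_space.nn_integral_stream_space[OF prob_space_exponential_density[OF assms]])
    measurable

lemma AE_exponential_regular:
  assumes "0 < l"
  shows "AE e in density lborel (exponential_density l). AE E in gaps l. regular (e ## E)"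
  using AE_regular[OF assms]
  by (subst (asm) prob_space.AE_stream_space[OF prob_space_exponential_density[OF assms]]) auto

text \<open>
  First-step analysis of the counts on a grid: a first bell outside the first interval leaves the
  remaining grid untouched by memorylessness, and a first bell inside it lowers one of the two
  prescribed counts by one.
\<close>

lemma grid_prob_empty_interval:
  assumes "0 < l" and "0 \<le> d" and "\<forall>(d, a, b) \<in> set xs. 0 \<le> d"
  shows "grid_prob l p ((d, 0, 0) # xs) = ennreal (exp (- l * d)) * grid_prob l p xs"
proof -
  let ?D = "density lborel (exponential_density l)"
  let ?K = "\<lambda>xs E. emeasure (coins p) {m. grid_counts 0 xs E m}"
  have late: "?K ((d, 0, 0) # xs) (e ## E) = indicator {d..} e * ?K xs ((e - d) ## E)"
    if regular: "regular (e ## E)" for e E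
  proof (cases "d \<le> e")
    case True
    then show ?thesis
      by (simp only: grid_counts_late[OF regular]) simp
  next
    case False
    then have "\<not> grid_counts 0 ((d, 0, 0) # xs) (e ## E) m" for m
      using grid_counts_early[OF regular, of d xs 0 0 "shd m" "stl m"] assms by auto
    with False show ?thesis
      by (simp del: grid_counts.simps)
  qed
  have [measurable]: "(\<lambda>e. \<integral>\<^sup>+E. ?K xs (e ## E) \<partial>gaps l) \<in> borel_measurable borel"
  proof -
    interpret prob_space "gaps l"
      by (rule prob_space.prob_space_stream_space[OF prob_space_exponential_density[OF assms(1)]])
    show ?thesis
      by measurable
  qed
  have "grid_prob l p ((d, 0, 0) # xs) =
      (\<integral>\<^sup>+e. indicator {d..} e * (\<integral>\<^sup>+E. ?K xs ((e - d) ## E) \<partial>gaps l) \<partial>?D)"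
    unfolding grid_prob_Stream[OF assms(1)]
  proof (rule nn_integral_cong_AE)
    show "AE e in ?D. (\<integral>\<^sup>+E. ?K ((d, 0, 0) # xs) (e ## E) \<partial>gaps l) =
      indicator {d..} e * (\<integral>\<^sup>+E. ?K xs ((e - d) ## E) \<partial>gaps l)"
      using AE_exponential_regular[OF assms(1)]
    proof eventually_elim
      case (elim e)
      then have "(\<integral>\<^sup>+E. ?K ((d, 0, 0) # xs) (e ## E) \<partial>gaps l) =
          (\<integral>\<^sup>+E. indicator {d..} e * ?K xs ((e - d) ## E) \<partial>gaps l)"
        using late by (intro nn_integral_cong_AE) (auto simp del: grid_counts.simps)
      also have "\<dots> = indicator {d..} e * (\<integral>\<^sup>+E. ?K xs ((e - d) ## E) \<partial>gaps l)"
        by (rule nn_integral_cmult) measurable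
      finally show ?case .
    qed
  qed
  also have "\<dots> = ennreal (exp (- l * d)) * grid_prob l p xs"
    unfolding grid_prob_Stream[OF assms(1)] using assms(2)
    by (subst nn_integral_exponential_memoryless) auto
  finally show ?thesis .
qed

lemma grid_prob_first_bell:
  assumes "0 < l" and p: "0 \<le> p" "p \<le> 1" and "0 < a + b" and "\<forall>(d, a, b) \<in> set xs. 0 \<le> d"
  shows "grid_prob l p ((d, a, b) # xs) =
    (\<integral>\<^sup>+e. indicator {0..d} e *
        ((if a = 0 then 0 else ennreal p * grid_prob l p ((d - e, a - 1, b) # xs)) +
         (if b = 0 then 0 else ennreal (1 - p) * grid_prob l p ((d - e, a, b - 1) # xs)))
      \<partial>density lborel (exponential_density l))"
proof -
  let ?D = "density lborel (exponential_density l)"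
  let ?K = "\<lambda>xs E. emeasure (coins p) {m. grid_counts 0 xs E m}"
  let ?w = "\<lambda>e E. (if a = 0 then 0 else ennreal p * ?K ((d - e, a - 1, b) # xs) E) +
    (if b = 0 then 0 else ennreal (1 - p) * ?K ((d - e, a, b - 1) # xs) E)"
  have early: "?K ((d, a, b) # xs) (e ## E) = indicator {0..d} e * ?w e E"
    if regular: "regular (e ## E)" and "e \<noteq> d" for e E
  proof (cases "e < d")
    case True
    have "?K ((d, a, b) # xs) (e ## E) =
        p * emeasure (coins p) {m. grid_counts 0 ((d, a, b) # xs) (e ## E) (True ## m)} +
        (1 - p) * emeasure (coins p) {m. grid_counts 0 ((d, a, b) # xs) (e ## E) (False ## m)}"
      using p by (subst prob_space.emeasure_stream_space[OF prob_space_measure_pmf])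
        (simp_all add: mult.commute del: grid_counts.simps)
    also have "\<dots> = ?w e E"
      unfolding grid_counts_early[OF regular True assms(5)]
      by (simp del: grid_counts.simps)
    finally show ?thesis
      using True regular by (simp add: regular_Stream)
  next
    case False
    then have "\<not> grid_counts 0 ((d, a, b) # xs) (e ## E) m" for m
      using grid_counts_late[OF regular, of d a b xs m] assms(4) by auto
    with False that(2) show ?thesis
      by (simp del: grid_counts.simps)
  qed
  \<comment> \<open>A first bell exactly at \<open>d\<close> belongs to the next interval, whereas
    the closed indicator includes it; this discrepancy is a null event.\<close>
  have "AE e in ?D. e \<noteq> d"
    using AE_lborel_singleton[of d] by (auto simp: AE_density elim!: eventually_mono)
  with AE_exponential_regular[OF assms(1)]
  have "AE e in ?D. (\<integral>\<^sup>+E. ?K ((d, a, b) # xs) (e ## E) \<partial>gaps l) = indicator {0..d} e *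
      ((if a = 0 then 0 else ennreal p * grid_prob l p ((d - e, a - 1, b) # xs)) +
       (if b = 0 then 0 else ennreal (1 - p) * grid_prob l p ((d - e, a, b - 1) # xs)))"
  proof eventually_elim
    case (elim e)
    then have "(\<integral>\<^sup>+E. ?K ((d, a, b) # xs) (e ## E) \<partial>gaps l) = (\<integral>\<^sup>+E. indicator {0..d} e * ?w e E \<partial>gaps l)"
      using early by (intro nn_integral_cong_AE) (auto simp del: grid_counts.simps)
    also have "\<dots> = indicator {0..d} e * (\<integral>\<^sup>+E. ?w e E \<partial>gaps l)"
      by (rule nn_integral_cmult) measurable
    also have "(\<integral>\<^sup>+E. ?w e E \<partial>gaps l) =
      (if a = 0 then 0 else ennreal p * grid_prob l p ((d - e, a - 1, b) # xs)) +
       (if b = 0 then 0 else ennreal (1 - p) * grid_prob l p ((d - e, a, b - 1) # xs))"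
      unfolding grid_prob_def
      by (cases "a = 0"; cases "b = 0") (simp_all add: nn_integral_add nn_integral_cmult del: grid_counts.simps)
    finally show ?case .
  qed
  then show ?thesis
    unfolding grid_prob_Stream[OF assms(1), of p "(d, a, b) # xs"] by (rule nn_integral_cong_AE)
qed

lemma DERIV_power_div_fact:
  "((\<lambda>u. (k * u) ^ n / fact n) has_real_derivative
     (if n = 0 then 0 else k * ((k * u) ^ (n - 1) / fact (n - 1)))) (at u)"
proof (cases n)
  case (Suc n')
  show ?thesis
    unfolding Suc
  proof (rule DERIV_cong)
    show "((\<lambda>u. (k * u) ^ Suc n' / fact (Suc n')) has_real_derivative
        real (Suc n') * ((k * 1) * (k * u) ^ n') / fact (Suc n')) (at u)"
      using DERIV_power_Suc[OF DERIV_cmult[OF DERIV_ident]]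
      by (intro DERIV_cdivide) (simp add: mult.assoc)
    have "real (Suc n') * x / fact (Suc n') = x / fact n'" for x :: real
      by (simp only: fact_Suc of_nat_mult mult_divide_mult_cancel_left of_nat_eq_0_iff nat.simps simp_thms)
    then show "real (Suc n') * ((k * 1) * (k * u) ^ n') / fact (Suc n') =
        (if Suc n' = 0 then 0 else k * ((k * u) ^ (Suc n' - 1) / fact (Suc n' - 1)))"
      by simp
  qed
qed simp

text \<open>Let \<open>h\<close> be the product of the two Poisson weights without their
  exponentials, which combine to \<open>exp (- (l * u))\<close> as the rates add up to
  \<open>l\<close>. The product rule gives \<open>h' u = l * exp (l * u) * w u\<close>, so the
  integrand has the antiderivative \<open>- (exp (- (l * d)) * h (d - e))\<close>. The end point
  \<open>e = d\<close> contributes nothing because \<open>h 0 = 0\<close> when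
  \<open>0 < a + b\<close>.\<close>

lemma nn_integral_poisson_weight_first_bell:
  assumes "0 < l" "0 \<le> p" "p \<le> 1" "0 < a + b" "0 \<le> d"
  defines "w u \<equiv>
    (if a = 0 then 0 else p * (poisson_weight (l * p * u) (a - 1) * poisson_weight (l * (1 - p) * u) b)) +
    (if b = 0 then 0 else (1 - p) * (poisson_weight (l * p * u) a * poisson_weight (l * (1 - p) * u) (b - 1)))"
  shows "(\<integral>\<^sup>+e. indicator {0..d} e * ennreal (w (d - e)) \<partial>density lborel (exponential_density l)) =
    ennreal (poisson_weight (l * p * d) a * poisson_weight (l * (1 - p) * d) b)"
proof -
  define h where "h u = (l * p * u) ^ a / fact a * ((l * (1 - p) * u) ^ b / fact b)" for u
  have weights: "poisson_weight (l * p * u) i * poisson_weight (l * (1 - p) * u) j =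
      exp (- (l * u)) * ((l * p * u) ^ i / fact i * ((l * (1 - p) * u) ^ j / fact j))" for u i j
  proof -
    have "exp (- (l * p * u)) * exp (- (l * (1 - p) * u)) = exp (- (l * u))"
      by (simp add: algebra_simps flip: exp_add)
    then show ?thesis
      by (simp add: poisson_weight_def)
  qed
  have deriv_h: "(h has_real_derivative l * exp (l * u) * w u) (at u)" for u
  proof -
    have "(h has_real_derivative
        (if a = 0 then 0 else l * p * ((l * p * u) ^ (a - 1) / fact (a - 1))) * ((l * (1 - p) * u) ^ b / fact b) +
        (if b = 0 then 0 else l * (1 - p) * ((l * (1 - p) * u) ^ (b - 1) / fact (b - 1))) * ((l * p * u) ^ a / fact a)) (at u)"
      unfolding h_def by (intro DERIV_mult DERIV_power_div_fact)
    moreover have "w u = exp (- (l * u)) *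
       ((if a = 0 then 0 else p * ((l * p * u) ^ (a - 1) / fact (a - 1))) * ((l * (1 - p) * u) ^ b / fact b) +
        (if b = 0 then 0 else (1 - p) * ((l * (1 - p) * u) ^ (b - 1) / fact (b - 1))) * ((l * p * u) ^ a / fact a))"
      unfolding w_def weights by (cases "a = 0"; cases "b = 0") (simp_all only: if_True if_False refl mult_zero_left add_0_left add_0_right distrib_left mult_ac)
    then have "l * exp (l * u) * w u = (exp (l * u) * exp (- (l * u))) *
       ((if a = 0 then 0 else l * p * ((l * p * u) ^ (a - 1) / fact (a - 1))) * ((l * (1 - p) * u) ^ b / fact b) +
        (if b = 0 then 0 else l * (1 - p) * ((l * (1 - p) * u) ^ (b - 1) / fact (b - 1))) * ((l * p * u) ^ a / fact a))"
      by (cases "a = 0"; cases "b = 0") (simp_all only: if_True if_False refl mult_zero_left add_0_left add_0_right distrib_left mult_ac)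
    ultimately show ?thesis
      by (simp only: exp_minus_inverse mult_1)
  qed
  have w_nonneg: "0 \<le> w u" if "0 \<le> u" for u
    using assms(1-3) that by (auto simp: w_def intro!: add_nonneg_nonneg mult_nonneg_nonneg poisson_weight_nonneg)
  have w_meas [measurable]: "w \<in> borel_measurable borel"
    unfolding w_def poisson_weight_def by measurable
  have "(\<integral>\<^sup>+e. indicator {0..d} e * ennreal (w (d - e)) \<partial>density lborel (exponential_density l)) =
      (\<integral>\<^sup>+e. ennreal (l * exp (- (l * e)) * w (d - e)) * indicator {0..d} e \<partial>lborel)"
  proof (subst nn_integral_density)
    show "(\<integral>\<^sup>+e. ennreal (exponential_density l e) * (indicator {0..d} e * ennreal (w (d - e))) \<partial>lborel) =
        (\<integral>\<^sup>+e. ennreal (l * exp (- (l * e)) * w (d - e)) * indicator {0..d} e \<partial>lborel)"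
    proof (rule nn_integral_cong)
      fix e
      show "ennreal (exponential_density l e) * (indicator {0..d} e * ennreal (w (d - e))) =
          ennreal (l * exp (- (l * e)) * w (d - e)) * indicator {0..d} e"
        using assms(1) w_nonneg[of "d - e"]
        by (cases "e \<in> {0..d}") (simp_all add: exponential_density_def ennreal_mult mult.commute)
    qed
  qed measurable
  also have "\<dots> = ennreal (- (exp (- (l * d)) * h (d - d)) - - (exp (- (l * d)) * h (d - 0)))"
  proof (rule nn_integral_FTC_Icc)
    fix e assume "e \<in> {0..d}"
    then show "0 \<le> l * exp (- (l * e)) * w (d - e)"
      using assms(1) w_nonneg by simp
    have "((\<lambda>e. h (d - e)) has_real_derivative l * exp (l * (d - e)) * w (d - e) * (0 - 1)) (at e)"
      by (rule DERIV_chain2[OF deriv_h]) (auto intro!: derivative_eq_intros)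
    then have "((\<lambda>e. - (exp (- (l * d)) * h (d - e))) has_real_derivative
        - (exp (- (l * d)) * (l * exp (l * (d - e)) * w (d - e) * (0 - 1)))) (at e)"
      by (intro DERIV_minus DERIV_cmult)
    moreover have "exp (- (l * d)) * exp (l * (d - e)) = exp (- (l * e))"
      by (simp add: algebra_simps flip: exp_add)
    ultimately show "((\<lambda>e. - (exp (- (l * d)) * h (d - e))) has_real_derivative l * exp (- (l * e)) * w (d - e)) (at e)"
      by (simp add: mult_ac)
  next
    show "(\<lambda>e. l * exp (- (l * e)) * w (d - e)) \<in> borel_measurable borel"
      by measurable
  qed (use assms(5) in simp)
  also have "h (d - d) = 0"
    using assms(4) by (simp add: h_def)
  finally show ?thesis
    by (simp add: weights h_def)
qed

text \<open>Contains at once the Poisson law of the counts, the independence of left and right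
  bells, and the independence of successive intervals. A first bell lowers \<open>a + b\<close> by
  one, hence the induction; the factor of the later intervals passes through the integral
  unchanged.\<close>

lemma grid_prob_Cons:
  assumes "0 < l" and p: "0 \<le> p" "p \<le> 1" and "0 \<le> d" and xs: "\<forall>(d, a, b) \<in> set xs. 0 \<le> d"
  shows "grid_prob l p ((d, a, b) # xs) =
    ennreal (poisson_weight (l * p * d) a * poisson_weight (l * (1 - p) * d) b) * grid_prob l p xs"
  using \<open>0 \<le> d\<close>
proof (induction "a + b" arbitrary: a b d)
  case 0
  have "exp (- l * d) = exp (- (l * p * d)) * exp (- (l * (1 - p) * d))"
    by (simp add: algebra_simps flip: exp_add)
  with 0 show ?case
    using grid_prob_empty_interval[OF \<open>0 < l\<close> \<open>0 \<le> d\<close> xs, of p] by (simp add: poisson_weight_def)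
next
  case (Suc n)
  let ?D = "density lborel (exponential_density l)"
  let ?pw = "\<lambda>u a b. poisson_weight (l * p * u) a * poisson_weight (l * (1 - p) * u) b"
  let ?w = "\<lambda>u. (if a = 0 then 0 else p * ?pw u (a - 1) b) + (if b = 0 then 0 else (1 - p) * ?pw u a (b - 1))"
  have "0 < a + b"
    using Suc.hyps(2) by linarith
  have "grid_prob l p ((d, a, b) # xs) =
      (\<integral>\<^sup>+e. indicator {0..d} e * ennreal (?w (d - e)) * grid_prob l p xs \<partial>?D)"
    unfolding grid_prob_first_bell[OF \<open>0 < l\<close> p \<open>0 < a + b\<close> xs]
  proof (rule nn_integral_cong)
    fix e
    show "indicator {0..d} e *
        ((if a = 0 then 0 else ennreal p * grid_prob l p ((d - e, a - 1, b) # xs)) +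
         (if b = 0 then 0 else ennreal (1 - p) * grid_prob l p ((d - e, a, b - 1) # xs))) =
        indicator {0..d} e * ennreal (?w (d - e)) * grid_prob l p xs"
    proof (cases "e \<in> {0..d}")
      case True
      then have nonneg: "0 \<le> ?pw (d - e) i j" for i j
        using \<open>0 < l\<close> p by (auto intro!: mult_nonneg_nonneg poisson_weight_nonneg)
      have "grid_prob l p ((d - e, a - 1, b) # xs) = ennreal (?pw (d - e) (a - 1) b) * grid_prob l p xs"
        if "a \<noteq> 0"
        using that True Suc.hyps(2) by (intro Suc.hyps(1)) auto
      moreover have "grid_prob l p ((d - e, a, b - 1) # xs) = ennreal (?pw (d - e) a (b - 1)) * grid_prob l p xs"
        if "b \<noteq> 0"
        using that True Suc.hyps(2) by (intro Suc.hyps(1)) auto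
      moreover have "ennreal (?w (d - e)) =
          (if a = 0 then 0 else ennreal p * ennreal (?pw (d - e) (a - 1) b)) +
          (if b = 0 then 0 else ennreal (1 - p) * ennreal (?pw (d - e) a (b - 1)))"
        using p nonneg by (simp add: ennreal_plus ennreal_mult del: ennreal_plus[symmetric])
      ultimately show ?thesis
        using True by (auto simp: distrib_right mult.assoc)
    qed simp
  qed
  also have "\<dots> = (\<integral>\<^sup>+e. indicator {0..d} e * ennreal (?w (d - e)) \<partial>?D) * grid_prob l p xs"
    unfolding poisson_weight_def by (rule nn_integral_multc) measurable
  also have "(\<integral>\<^sup>+e. indicator {0..d} e * ennreal (?w (d - e)) \<partial>?D) = ennreal (?pw d a b)"
    using nn_integral_poisson_weight_first_bell[OF \<open>0 < l\<close> p \<open>0 < a + b\<close> \<open>0 \<le> d\<close>] .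
  finally show ?case .
qed

section \<open>Poisson processes from their counts on grids\<close>

text \<open>The product of countable discrete spaces is again discrete because \<open>I\<close> is
  finite, so its atoms determine the joint law. Atoms of product form thus make it a product
  measure, which yields marginals and independence.\<close>

lemma (in prob_space)
  fixes X :: "'i \<Rightarrow> 'a \<Rightarrow> nat" and p :: "'i \<Rightarrow> nat pmf"
  assumes I: "finite I"
    and X [measurable]: "\<And>i. X i \<in> M \<rightarrow>\<^sub>M count_space UNIV"
    and joint: "\<And>k. prob {\<omega> \<in> space M. \<forall>i\<in>I. X i \<omega> = k i} = (\<Prod>i\<in>I. pmf (p i) (k i))"
  shows discrete_joint_law_marginal: "i \<in> I \<Longrightarrow> distr M (count_space UNIV) (X i) = measure_pmf (p i)"
    and discrete_joint_law_indep: "indep_vars (\<lambda>_. count_space UNIV) X I"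
proof -
  let ?C = "PiM I (\<lambda>_. count_space (UNIV :: nat set))"
  let ?X = "\<lambda>\<omega>. \<lambda>i\<in>I. X i \<omega>"
  interpret P: product_sigma_finite "\<lambda>i. measure_pmf (p i)" ..
  have C: "?C = count_space (PiE I (\<lambda>_. UNIV))"
    using I by (intro count_space_PiM_finite) auto
  have X_meas: "?X \<in> M \<rightarrow>\<^sub>M ?C"
    by (intro measurable_restrict X)
  have eq: "distr M ?C ?X = PiM I (\<lambda>i. measure_pmf (p i))"
  proof (rule measure_eqI_countable)
    show "sets (distr M ?C ?X) = Pow (PiE I (\<lambda>_. UNIV))"
      by (simp add: C)
    have "sets (PiM I (\<lambda>i. measure_pmf (p i))) = sets ?C"
      by (intro sets_PiM_cong) auto
    then show "sets (PiM I (\<lambda>i. measure_pmf (p i))) = Pow (PiE I (\<lambda>_. UNIV))"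
      by (simp add: C)
    show "countable (PiE I (\<lambda>_. UNIV :: nat set))"
      using I by (intro countable_PiE) auto
    fix k :: "'i \<Rightarrow> nat" assume k: "k \<in> PiE I (\<lambda>_. UNIV)"
    have "?X -` {k} \<inter> space M = {\<omega> \<in> space M. \<forall>i\<in>I. X i \<omega> = k i}"
      using k by (auto simp: fun_eq_iff PiE_def extensional_def)
    then have "emeasure (distr M ?C ?X) {k} = ennreal (\<Prod>i\<in>I. pmf (p i) (k i))"
      using k by (subst emeasure_distr[OF X_meas]) (simp_all add: C emeasure_eq_measure joint)
    also have "\<dots> = (\<Prod>i\<in>I. emeasure (measure_pmf (p i)) {k i})"
      by (simp add: emeasure_pmf_single prod_ennreal)
    also have "\<dots> = emeasure (PiM I (\<lambda>i. measure_pmf (p i))) (PiE I (\<lambda>i. {k i}))"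
      using I by (intro P.emeasure_PiM[symmetric]) auto
    also have "PiE I (\<lambda>i. {k i}) = {k}"
      using k by (intro PiE_singleton) (simp add: PiE_def)
    finally show "emeasure (distr M ?C ?X) {k} = emeasure (PiM I (\<lambda>i. measure_pmf (p i))) {k}" .
  qed
  show marginal: "distr M (count_space UNIV) (X i) = measure_pmf (p i)" if "i \<in> I" for i
  proof -
    have "distr M (count_space UNIV) (X i) = distr (distr M ?C ?X) (count_space UNIV) (\<lambda>f. f i)"
      using that by (subst distr_distr) (auto simp: comp_def)
    also have "\<dots> = distr (PiM I (\<lambda>i. measure_pmf (p i))) (measure_pmf (p i)) (\<lambda>f. f i)"
      unfolding eq by (intro distr_cong) auto
    also have "\<dots> = measure_pmf (p i)"
      using that by (intro distr_PiM_component prob_space_measure_pmf)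
    finally show ?thesis .
  qed
  show "indep_vars (\<lambda>_. count_space UNIV) X I"
  proof (cases "I = {}")
    case True
    then show ?thesis
      by (simp add: indep_vars_def indep_sets_def)
  next
    case False
    have "PiM I (\<lambda>i. distr M (count_space UNIV) (X i)) = PiM I (\<lambda>i. measure_pmf (p i))"
      by (intro PiM_cong marginal) auto
    then show ?thesis
      using eq by (subst indep_vars_iff_distr_eq_PiM[OF False X]) simp
  qed
qed

section \<open>Cylinder sets of point configurations\<close>

lemma card_point_measurable:
  assumes "0 \<le> s"
  shows "(\<lambda>S. card (S \<inter> {s..<t})) \<in> point_space \<rightarrow>\<^sub>M count_space UNIV"
proof (cases "s < t")
  case True
  have "(\<lambda>S. card (S \<inter> {s..<t})) -` {n} \<inter> space point_space \<in> sets point_space" for n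
  proof -
    have "(\<lambda>S. card (S \<inter> {s..<t})) -` {n} \<inter> space point_space =
        {S \<in> locally_finite_points. card (S \<inter> {s..<t}) = n}"
      by (auto simp: point_space_def space_measure_of_conv)
    also have "\<dots> \<in> sets point_space"
      unfolding point_space_def using assms True by (intro in_measure_of) auto
    finally show ?thesis .
  qed
  then show ?thesis
    by (simp add: measurable_count_space_eq2_countable)
qed simp

lemma space_point_space [simp]: "space point_space = locally_finite_points"
  by (auto simp: point_space_def space_measure_of_conv)

text \<open>A generator closed under intersections, as the extension of independence requires;
  conditions on a single interval are not. Counts from time 0 suffice since other counts are their
  differences, and the arbitrary \<open>Q\<close> lets two conditions be merged into one.\<close>

definition finite_cylinders :: "real set set set" where
  "finite_cylinders =
    {{S \<in> locally_finite_points. (\<lambda>t\<in>T. card (S \<inter> {0..<t})) \<in> Q} | T Q. finite T \<and> T \<subseteq> {0..}}"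

lemma finite_locally_finite: "S \<in> locally_finite_points \<Longrightarrow> finite (S \<inter> {s..<t})"
proof (rule finite_subset)
  assume S: "S \<in> locally_finite_points"
  then show "S \<inter> {s..<t} \<subseteq> S \<inter> {0..t}"
    by (auto simp: locally_finite_points_def)
  show "finite (S \<inter> {0..t})"
    using S by (auto simp: locally_finite_points_def)
qed

lemma card_points_split:
  assumes "S \<in> locally_finite_points" "r \<le> s" "s \<le> t"
  shows "card (S \<inter> {r..<t}) = card (S \<inter> {r..<s}) + card (S \<inter> {s..<t})"
proof -
  have "S \<inter> {r..<t} = (S \<inter> {r..<s}) \<union> (S \<inter> {s..<t})"
    using assms(2,3) by auto
  then show ?thesis
    using finite_locally_finite[OF assms(1)] by (auto intro!: card_Un_disjoint)
qed

lemma sets_point_space: "sets point_space = sigma_sets locally_finite_points finite_cylinders"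
proof
  show "sets point_space \<subseteq> sigma_sets locally_finite_points finite_cylinders"
  proof -
    have "{S \<in> locally_finite_points. card (S \<inter> {s..<t}) = n} \<in> finite_cylinders"
      if "0 \<le> s" "s < t" for s t n
    proof -
      have "{S \<in> locally_finite_points. card (S \<inter> {s..<t}) = n} =
          {S \<in> locally_finite_points. (\<lambda>u\<in>{s, t}. card (S \<inter> {0..<u})) \<in> {f. f t = f s + n}}"
      proof (intro Collect_cong conj_cong refl)
        fix S assume "S \<in> locally_finite_points"
        from card_points_split[OF this that(1) less_imp_le[OF that(2)]]
        show "card (S \<inter> {s..<t}) = n \<longleftrightarrow>
            (\<lambda>u\<in>{s, t}. card (S \<inter> {0..<u})) \<in> {f. f t = f s + n}"
          by simp
      qed
      then show ?thesis
        unfolding finite_cylinders_def using that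
        by (intro CollectI exI[of _ "{s, t}"] exI[of _ "{f. f t = f s + n}"] conjI) auto
    qed
    then have "{{S \<in> locally_finite_points. card (S \<inter> {s..<t}) = n} | s t n. 0 \<le> s \<and> s < t}
        \<subseteq> finite_cylinders"
      by auto
    moreover have "sets point_space = sigma_sets locally_finite_points
        {{S \<in> locally_finite_points. card (S \<inter> {s..<t}) = n} | s t n. 0 \<le> s \<and> s < t}"
      unfolding point_space_def by (intro sets_measure_of) auto
    ultimately show ?thesis
      by (simp add: sigma_sets_mono')
  qed
  have "finite_cylinders \<subseteq> sets point_space"
  proof
    fix G assume "G \<in> finite_cylinders"
    then obtain T Q where T: "finite T" "T \<subseteq> {0..}"
      and G: "G = {S \<in> locally_finite_points. (\<lambda>t\<in>T. card (S \<inter> {0..<t})) \<in> Q}"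
      by (auto simp: finite_cylinders_def)
    have "(\<lambda>S. \<lambda>t\<in>T. card (S \<inter> {0..<t})) \<in> point_space \<rightarrow>\<^sub>M PiM T (\<lambda>_. count_space UNIV)"
      by (intro measurable_restrict card_point_measurable) simp
    also have "PiM T (\<lambda>_. count_space UNIV) = count_space (PiE T (\<lambda>_. UNIV :: nat set))"
      using T by (intro count_space_PiM_finite) auto
    finally have "(\<lambda>S. \<lambda>t\<in>T. card (S \<inter> {0..<t})) -` (Q \<inter> PiE T (\<lambda>_. UNIV)) \<inter> space point_space \<in> sets point_space"
      by (rule measurable_sets) simp
    also have "(\<lambda>S. \<lambda>t\<in>T. card (S \<inter> {0..<t})) -` (Q \<inter> PiE T (\<lambda>_. UNIV)) \<inter> space point_space = G"
      by (auto simp: G)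
    finally show "G \<in> sets point_space" .
  qed
  from sets.sigma_sets_subset[OF this] show "sigma_sets locally_finite_points finite_cylinders \<subseteq> sets point_space"
    by simp
qed

lemma Int_stable_finite_cylinders: "Int_stable finite_cylinders"
proof (rule Int_stableI)
  fix G H assume "G \<in> finite_cylinders" "H \<in> finite_cylinders"
  then obtain T Q T' Q' where T: "finite T" "T \<subseteq> {0..}" "finite T'" "T' \<subseteq> {0..}"
    and G: "G = {S \<in> locally_finite_points. (\<lambda>t\<in>T. card (S \<inter> {0..<t})) \<in> Q}"
    and H: "H = {S \<in> locally_finite_points. (\<lambda>t\<in>T'. card (S \<inter> {0..<t})) \<in> Q'}"
    by (auto simp: finite_cylinders_def)
  have "(\<lambda>t\<in>T. (\<lambda>t\<in>T \<union> T'. card (S \<inter> {0..<t})) t) = (\<lambda>t\<in>T. card (S \<inter> {0..<t}))"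
    "(\<lambda>t\<in>T'. (\<lambda>t\<in>T \<union> T'. card (S \<inter> {0..<t})) t) = (\<lambda>t\<in>T'. card (S \<inter> {0..<t}))" for S :: "real set"
    by (auto simp: restrict_def fun_eq_iff)
  then have "G \<inter> H = {S \<in> locally_finite_points. (\<lambda>t\<in>T \<union> T'. card (S \<inter> {0..<t})) \<in>
      {f. restrict f T \<in> Q \<and> restrict f T' \<in> Q'}}"
    unfolding G H by auto
  with T show "G \<inter> H \<in> finite_cylinders"
    unfolding finite_cylinders_def
    by (intro CollectI exI[of _ "T \<union> T'"] exI[of _ "{f. restrict f T \<in> Q \<and> restrict f T' \<in> Q'}"] conjI) auto
qed

lemma locally_finite_points_in_finite_cylinders: "locally_finite_points \<in> finite_cylinders"
  unfolding finite_cylinders_def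
  by (intro CollectI exI[of _ "{}"] exI[of _ UNIV]) auto

text \<open>Grids are infinite sequences, so the sorted list of times is continued by repeating its
  last entry. The resulting empty intervals are the reason for \<open>mono\<close> in place of
  strict monotonicity.\<close>

lemma finite_times_on_grid:
  fixes T :: "real set"
  assumes "finite T" "T \<subseteq> {0..}"
  obtains g :: "nat \<Rightarrow> real" and r where "mono g" "g 0 = 0" "T \<subseteq> g ` {..r}"
proof -
  define xs where "xs = sorted_list_of_set (insert 0 T)"
  define r where "r = length xs - 1"
  have set_xs: "set xs = insert 0 T" and sorted: "sorted xs"
    unfolding xs_def using assms(1)
    by (simp_all only: set_sorted_list_of_set finite_insert sorted_sorted_list_of_set)
  then have len: "length xs = Suc r"
    by (cases xs) (auto simp: r_def)
  obtain i where "i < length xs" "xs ! i = 0"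
    using set_xs by (metis in_set_conv_nth insertI1)
  moreover have "0 \<le> xs ! 0"
    using len set_xs assms(2) nth_mem[of 0 xs] by auto
  ultimately have 0: "xs ! 0 = 0"
    using sorted_nth_mono[OF sorted, of 0 i] by simp
  show ?thesis
  proof
    show "mono (\<lambda>i. xs ! min i r)"
      using sorted len by (intro monoI sorted_nth_mono) auto
    show "xs ! min 0 r = 0"
      using 0 by simp
    show "T \<subseteq> (\<lambda>i. xs ! min i r) ` {..r}"
    proof
      fix t assume "t \<in> T"
      then obtain i where "i < length xs" "xs ! i = t"
        using set_xs by (metis in_set_conv_nth insertI2)
      with len show "t \<in> (\<lambda>i. xs ! min i r) ` {..r}"
        by (intro image_eqI[of _ _ i]) auto
    qed
  qed
qed

lemma card_points_grid:
  assumes "S \<in> locally_finite_points" "mono g" "g 0 = 0"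
  shows "card (S \<inter> {0..<g j}) = (\<Sum>i<j. card (S \<inter> {g i..<g (Suc i)}))"
proof (induction j)
  case (Suc j)
  have "0 \<le> g j" "g j \<le> g (Suc j)"
    using assms(2,3) by (metis monoD le0) (metis assms(2) monoD le_SucI order_refl)
  from card_points_split[OF assms(1) this] Suc show ?case
    by simp
qed (simp add: assms(3))

lemma (in prob_space) indep_sets_reindex:
  assumes h: "inj_on h I" and F: "indep_sets F (h ` I)"
  shows "indep_sets (\<lambda>i. F (h i)) I"
proof (rule indep_setsI)
  show "F (h i) \<subseteq> events" if "i \<in> I" for i
    using F that by (auto simp: indep_sets_def)
  fix A J assume J: "J \<noteq> {}" "J \<subseteq> I" "finite J" and A: "\<forall>j\<in>J. A j \<in> F (h j)"
  have inj: "inj_on h J"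
    using h J(2) by (rule inj_on_subset)
  let ?B = "\<lambda>k. A (inv_into J h k)"
  have "prob (\<Inter>k\<in>h ` J. ?B k) = (\<Prod>k\<in>h ` J. prob (?B k))"
    using J A inj by (intro indep_setsD[OF F]) (auto simp: inv_into_f_f)
  then show "prob (\<Inter>j\<in>J. A j) = (\<Prod>j\<in>J. prob (A j))"
    using inj by (simp add: prod.reindex inv_into_f_f)
qed

lemma (in prob_space) indep_vars_reindex:
  assumes h: "inj_on h I" and X: "indep_vars M' X (h ` I)"
  shows "indep_vars (\<lambda>i. M' (h i)) (\<lambda>i. X (h i)) I"
  using X indep_sets_reindex[OF h] unfolding indep_vars_def2 by auto

text \<open>The Poisson law with parameter 0 is needed for empty grid intervals.\<close>

definition poisson_pmf0 :: "real \<Rightarrow> nat pmf" where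
  "poisson_pmf0 r = (if 0 < r then poisson_pmf r else return_pmf 0)"

lemma pmf_poisson_pmf0: "0 \<le> r \<Longrightarrow> pmf (poisson_pmf0 r) n = poisson_weight r n"
  by (cases n) (auto simp: poisson_pmf0_def poisson_weight_def)

text \<open>A criterion by joint atoms: the counts of both processes on every finite grid starting
  at 0 have product Poisson probabilities. It is applied once to each of the two coupled
  pairs.\<close>

locale poisson_grid_counts = prob_space M for M :: "'w measure" +
  fixes rate :: "bool \<Rightarrow> real" and Z :: "bool \<Rightarrow> 'w \<Rightarrow> real set"
  assumes rate_pos: "0 < rate c"
    and Z_measurable [measurable]: "Z c \<in> M \<rightarrow>\<^sub>M point_space"
    and grid: "mono g \<Longrightarrow> g 0 = 0 \<Longrightarrow>
      prob {\<omega> \<in> space M. \<forall>i<r. \<forall>c. card (Z c \<omega> \<inter> {g i..<g (Suc i)}) = k c i} =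
      (\<Prod>i<r. \<Prod>c\<in>UNIV. poisson_weight (rate c * (g (Suc i) - g i)) (k c i))"
begin

definition N :: "(nat \<Rightarrow> real) \<Rightarrow> bool \<times> nat \<Rightarrow> 'w \<Rightarrow> nat" where
  "N g = (\<lambda>(c, i) \<omega>. card (Z c \<omega> \<inter> {g i..<g (Suc i)}))"

lemma grid_nonneg: "mono g \<Longrightarrow> g 0 = 0 \<Longrightarrow> 0 \<le> (g i :: real)" for g :: "nat \<Rightarrow> real"
  by (metis monoD le0)

lemma N_measurable:
  assumes "mono g" "g 0 = 0"
  shows "N g ci \<in> M \<rightarrow>\<^sub>M count_space UNIV"
  using measurable_compose[OF Z_measurable card_point_measurable[OF grid_nonneg[OF assms]]]
  by (auto simp: N_def split: prod.split)

lemma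
  assumes g: "mono g" "g 0 = 0"
  shows distr_N: "i < r \<Longrightarrow> distr M (count_space UNIV) (N g (c, i)) = poisson_pmf0 (rate c * (g (Suc i) - g i))"
    and indep_N: "indep_vars (\<lambda>_. count_space UNIV) (N g) (UNIV \<times> {..<r})"
proof -
  let ?p = "\<lambda>(c, i). poisson_pmf0 (rate c * (g (Suc i) - g i))"
  have "prob {\<omega> \<in> space M. \<forall>ci\<in>UNIV \<times> {..<r}. N g ci \<omega> = k ci} = (\<Prod>ci\<in>UNIV \<times> {..<r}. pmf (?p ci) (k ci))" for k
  proof -
    have "(\<Prod>ci\<in>UNIV \<times> {..<r}. pmf (?p ci) (k ci)) = (\<Prod>c\<in>UNIV. \<Prod>i<r. pmf (?p (c, i)) (k (c, i)))"
      by (simp add: prod.cartesian_product case_prod_unfold)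
    also have "\<dots> = (\<Prod>i<r. \<Prod>c\<in>UNIV. pmf (?p (c, i)) (k (c, i)))"
      by (rule prod.swap)
    also have "\<dots> = (\<Prod>i<r. \<Prod>c\<in>UNIV. poisson_weight (rate c * (g (Suc i) - g i)) (k (c, i)))"
      using g(1) rate_pos by (intro prod.cong refl)
        (auto simp: pmf_poisson_pmf0 mult_nonneg_nonneg monoD less_imp_le)
    also have "\<dots> = prob {\<omega> \<in> space M. \<forall>i<r. \<forall>c. card (Z c \<omega> \<inter> {g i..<g (Suc i)}) = k (c, i)}"
      by (rule grid[OF g, symmetric])
    also have "\<dots> = prob {\<omega> \<in> space M. \<forall>ci\<in>UNIV \<times> {..<r}. N g ci \<omega> = k ci}"
      by (intro arg_cong[where f = prob]) (auto simp: N_def)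
    finally show ?thesis ..
  qed
  note joint = discrete_joint_law_marginal[OF _ N_measurable[OF g] this] discrete_joint_law_indep[OF _ N_measurable[OF g] this]
  show "distr M (count_space UNIV) (N g (c, i)) = poisson_pmf0 (rate c * (g (Suc i) - g i))" if "i < r"
    using joint(1)[of "(c, i)"] that by simp
  show "indep_vars (\<lambda>_. count_space UNIV) (N g) (UNIV \<times> {..<r})"
    by (rule joint(2)) simp
qed

lemma poisson_process: "poisson_process M (rate c) (Z c)"
  unfolding poisson_process_def
proof (intro conjI allI impI Z_measurable)
  fix s t :: real assume st: "0 \<le> s \<and> s < t"
  \<comment> \<open>The grid \<open>0, s, t, t, ...\<close>, in which \<open>[s, t)\<close> is the
    interval with index 1.\<close>
  define g :: "nat \<Rightarrow> real" where "g i = (if i = 0 then 0 else if i = 1 then s else t)" for i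
  have "mono g" "g 0 = 0"
    using st by (auto simp: g_def intro!: monoI)
  from distr_N[OF this, of 1 2 c]
  show "distr M (count_space UNIV) (\<lambda>\<omega>. card (Z c \<omega> \<inter> {s..<t})) = poisson_pmf (rate c * (t - s))"
    using st rate_pos[of c] by (simp add: N_def g_def poisson_pmf0_def)
next
  fix t :: "nat \<Rightarrow> real" assume t: "0 \<le> t 0 \<and> mono t"
  \<comment> \<open>The given times need not start at 0, so 0 is put in front and all indices move
    by one.\<close>
  define g :: "nat \<Rightarrow> real" where "g i = (case i of 0 \<Rightarrow> 0 | Suc i \<Rightarrow> t i)" for i
  have g: "mono g" "g 0 = 0"
    using t by (auto simp: g_def mono_iff_le_Suc split: nat.split)
  have N: "N g (c, Suc i) = (\<lambda>\<omega>. card (Z c \<omega> \<inter> {t i..<t (Suc i)}))" for i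
    by (simp add: N_def g_def)
  \<comment> \<open>Independence of an infinite family is a property of its finite subfamilies, each
    of which lies in a finite part of the grid.\<close>
  have "indep_vars (\<lambda>_. count_space UNIV) (\<lambda>i. N g (c, Suc i)) J" if "finite J" for J
  proof -
    obtain r where "J \<subseteq> {..<r}"
      using \<open>finite J\<close> by (metis finite_nat_iff_bounded)
    then have "(\<lambda>i. (c, Suc i)) ` J \<subseteq> UNIV \<times> {..<Suc r}"
      by auto
    from indep_vars_subset[OF indep_N[OF g] this] show ?thesis
      by (rule indep_vars_reindex[rotated]) (auto simp: inj_on_def)
  qed
  then have "indep_vars (\<lambda>_. count_space UNIV) (\<lambda>i. N g (c, Suc i)) UNIV"
    unfolding indep_vars_def2 using N_measurable[OF g] by (subst indep_sets_finite_index_sets) auto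
  then show "indep_vars (\<lambda>_. count_space UNIV) (\<lambda>i \<omega>. card (Z c \<omega> \<inter> {t i..<t (Suc i)})) UNIV"
    by (simp add: N)
qed

text \<open>Both time sets are placed on one grid. The counts from 0 are then sums of interval
  counts, so the two events are functions of disjoint parts of the independent family
  \<open>N g\<close>.\<close>

lemma indep_finite_cylinders:
  assumes "G \<in> finite_cylinders" "H \<in> finite_cylinders"
  shows "prob (Z True -` G \<inter> space M \<inter> (Z False -` H \<inter> space M)) =
    prob (Z True -` G \<inter> space M) * prob (Z False -` H \<inter> space M)"
proof -
  obtain T Q T' Q' where T: "finite T" "T \<subseteq> {0..}" "finite T'" "T' \<subseteq> {0..}"
    and G: "G = {S \<in> locally_finite_points. (\<lambda>t\<in>T. card (S \<inter> {0..<t})) \<in> Q}"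
    and H: "H = {S \<in> locally_finite_points. (\<lambda>t\<in>T'. card (S \<inter> {0..<t})) \<in> Q'}"
    using assms by (auto simp: finite_cylinders_def)
  have T_Un: "finite (T \<union> T')" "T \<union> T' \<subseteq> {0..}"
    using T by auto
  obtain g :: "nat \<Rightarrow> real" and r where g: "mono g" "g 0 = 0" and cover: "T \<union> T' \<subseteq> g ` {..r}"
    using finite_times_on_grid[OF T_Un] by blast
  define j where "j t = (SOME j. j \<le> r \<and> g j = t)" for t
  have j: "j t \<le> r" "g (j t) = t" if "t \<in> T \<union> T'" for t
  proof -
    have "\<exists>j. j \<le> r \<and> g j = t"
      using that cover by auto
    from someI_ex[OF this] show "j t \<le> r" "g (j t) = t"
      by (auto simp: j_def)
  qed
  let ?I = "\<lambda>c. {c} \<times> {..<r}"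
  let ?V = "\<lambda>c \<omega>. \<lambda>ci\<in>?I c. N g ci \<omega>"
  let ?count = "\<lambda>c T v. \<lambda>t\<in>T. \<Sum>i<j t. v (c :: bool, i) :: nat"
  have C: "PiM (?I c) (\<lambda>_. count_space UNIV) = count_space (PiE (?I c) (\<lambda>_. UNIV :: nat set))" for c
    by (intro count_space_PiM_finite) auto
  have count: "(\<lambda>t\<in>U. card (Z c \<omega> \<inter> {0..<t})) = ?count c U (?V c \<omega>)"
    if "\<omega> \<in> space M" "U \<subseteq> T \<union> T'" for c \<omega> U
  proof (rule restrict_ext)
    fix t assume "t \<in> U"
    then have t: "t \<in> T \<union> T'"
      using that(2) by auto
    have "Z c \<omega> \<in> locally_finite_points"
      using measurable_space[OF Z_measurable that(1)] by simp
    from card_points_grid[OF this g, of "j t"] j[OF t]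
    show "card (Z c \<omega> \<inter> {0..<t}) = (\<Sum>i<j t. ?V c \<omega> (c, i))"
      by (simp add: N_def)
  qed
  let ?Q = "{v \<in> PiE (?I True) (\<lambda>_. UNIV). ?count True T v \<in> Q}"
  let ?Q' = "{v \<in> PiE (?I False) (\<lambda>_. UNIV). ?count False T' v \<in> Q'}"
  have Z: "Z c \<omega> \<in> locally_finite_points" if "\<omega> \<in> space M" for c \<omega>
    using measurable_space[OF Z_measurable that] by simp
  have G': "Z True -` G \<inter> space M = ?V True -` ?Q \<inter> space M"
    using Z count[of _ T True] by (auto simp: G)
  have H': "Z False -` H \<inter> space M = ?V False -` ?Q' \<inter> space M"
    using Z count[of _ T' False] by (auto simp: H)
  have "indep_var (PiM (?I True) (\<lambda>_. count_space UNIV)) (?V True)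
      (PiM (?I False) (\<lambda>_. count_space UNIV)) (?V False)"
    by (rule indep_var_restrict[OF indep_N[OF g, of r]]) auto
  from indep_varD[OF this, of ?Q ?Q'] show ?thesis
    unfolding G' H' C by (simp add: vimage_Times) (simp add: vimage_def Int_ac)
qed

lemma indep: "indep_var point_space (Z True) point_space (Z False)"
proof -
  have "indep_vars (case_bool point_space point_space) (case_bool (Z True) (Z False)) UNIV \<longleftrightarrow>
    (\<forall>A\<in>Pi UNIV (\<lambda>_. finite_cylinders).
      prob (\<Inter>j\<in>UNIV. case_bool (Z True) (Z False) j -` A j \<inter> space M) =
      (\<Prod>j\<in>UNIV. prob (case_bool (Z True) (Z False) j -` A j \<inter> space M)))"
    using Int_stable_finite_cylinders locally_finite_points_in_finite_cylinders sets_point_space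
    by (intro indep_vars_finite) (auto split: bool.split simp: finite_cylinders_def)
  moreover have "prob (\<Inter>j\<in>UNIV. case_bool (Z True) (Z False) j -` A j \<inter> space M) =
      (\<Prod>j\<in>UNIV. prob (case_bool (Z True) (Z False) j -` A j \<inter> space M))"
    if "A \<in> Pi UNIV (\<lambda>_. finite_cylinders)" for A
    using indep_finite_cylinders[of "A True" "A False"] that
    by (simp add: UNIV_bool Pi_iff Int_ac mult.commute)
  ultimately show ?thesis
    unfolding indep_var_def by blast
qed

lemma indep_poisson_processes:
  "indep_poisson_processes M (rate True) (rate False) (Z True) (Z False)"
  unfolding indep_poisson_processes_def using poisson_process indep by blast

end

text \<open>A point at \<open>u\<close> forces a positive count in each interval
  \<open>[u, u + 1 / Suc n)\<close>, an event of probability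
  \<open>1 - exp (- (\<rho> / Suc n))\<close>, which tends to 0. Countability of \<open>L\<close>
  unites the null sets.\<close>

lemma poisson_process_avoids:
  assumes "prob_space M" "0 < \<rho>" "poisson_process M \<rho> X" "countable L" "L \<subseteq> {0..}"
  shows "AE \<omega> in M. L \<inter> X \<omega> = {}"
proof -
  interpret prob_space M by fact
  have X [measurable]: "X \<in> M \<rightarrow>\<^sub>M point_space"
    using assms(3) by (simp add: poisson_process_def)
  have "AE \<omega> in M. u \<notin> X \<omega>" if "u \<in> L" for u
  proof -
    have u: "0 \<le> u"
      using that assms(5) by auto
    let ?A = "\<lambda>n. {\<omega> \<in> space M. card (X \<omega> \<inter> {u..<u + 1 / Suc n}) \<noteq> 0}"
    have meas: "(\<lambda>\<omega>. card (X \<omega> \<inter> {u..<u + 1 / Suc n})) \<in> M \<rightarrow>\<^sub>M count_space UNIV" for n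
      by (rule measurable_compose[OF X card_point_measurable[OF u]])
    have A [measurable]: "?A n \<in> sets M" for n
      using measurable_sets[OF meas, of "- {0}"] by (simp add: vimage_def Int_def conj_commute)
    have prob_A: "prob (?A n) = 1 - exp (- (\<rho> / Suc n))" for n
    proof -
      have "distr M (count_space UNIV) (\<lambda>\<omega>. card (X \<omega> \<inter> {u..<u + 1 / Suc n})) =
          measure_pmf (poisson_pmf (\<rho> * (u + 1 / Suc n - u)))"
        using assms(3) u unfolding poisson_process_def by simp
      then have "measure (distr M (count_space UNIV) (\<lambda>\<omega>. card (X \<omega> \<inter> {u..<u + 1 / Suc n}))) {0} =
          exp (- (\<rho> / Suc n))"
        using assms(2) by (simp add: measure_pmf_single)
      then have "prob {\<omega> \<in> space M. card (X \<omega> \<inter> {u..<u + 1 / Suc n}) = 0} = exp (- (\<rho> / Suc n))"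
        by (subst (asm) measure_distr[OF meas]) (simp_all add: vimage_def Int_def conj_commute)
      then show ?thesis
        using prob_neg[of "\<lambda>\<omega>. card (X \<omega> \<inter> {u..<u + 1 / Suc n}) = 0"] measurable_sets[OF meas, of "{0}" n]
        by (simp add: vimage_def Int_def conj_commute del: of_nat_Suc card_0_eq)
    qed
    have "prob (\<Inter>n. ?A n) \<le> 1 - exp (- (\<rho> / Suc n))" for n
      unfolding prob_A[symmetric] by (intro finite_measure_mono A) blast
    moreover have "(\<lambda>n. 1 - exp (- (\<rho> / Suc n))) \<longlonglongrightarrow> 1 - exp (- 0)"
      by (intro tendsto_intros LIMSEQ_Suc[OF lim_const_over_n])
    ultimately have "prob (\<Inter>n. ?A n) \<le> 0"
      by (intro LIMSEQ_le_const[of "\<lambda>n. 1 - exp (- (\<rho> / Suc n))" 0]) auto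
    then have "emeasure M (\<Inter>n. ?A n) = 0"
      by (simp add: emeasure_eq_measure measure_le_0_iff)
    then show ?thesis
    proof (intro AE_I[where N = "\<Inter>n. ?A n"] subsetI)
      fix \<omega> assume \<omega>: "\<omega> \<in> {\<omega> \<in> space M. \<not> u \<notin> X \<omega>}"
      then have "X \<omega> \<in> locally_finite_points"
        using measurable_space[OF X] by simp
      then have "card (X \<omega> \<inter> {u..<u + 1 / Suc n}) \<noteq> 0" for n
        using \<omega> finite_locally_finite[of "X \<omega>" u "u + 1 / Suc n"] by auto
      then show "\<omega> \<in> (\<Inter>n. ?A n)"
        using \<omega> by auto
    next
      show "(\<Inter>n. ?A n) \<in> sets M"
        using A by (intro sets.countable_INT) blast+
    qed
  qed
  then have "AE \<omega> in M. \<forall>u\<in>L. u \<notin> X \<omega>"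
    using assms(4) by (simp add: AE_ball_countable)
  then show ?thesis
    by eventually_elim auto
qed

section \<open>The coupling\<close>

text \<open>The default \<open>{}\<close> off \<open>regular\<close> makes the set locally finite
  for every outcome, as a map into \<open>point_space\<close> must be.\<close>

definition bells :: "real stream \<Rightarrow> bool stream \<Rightarrow> bool \<Rightarrow> real set" where
  "bells E m c = (if regular E then bell_time E ` {n. m !! n = c} else {})"

lemma card_bells:
  assumes "regular E"
  shows "card (bells E m c \<inter> {s..<t}) = bell_count E m c s t"
proof -
  have "bells E m c \<inter> {s..<t} = bell_time E ` {n. m !! n = c \<and> s \<le> bell_time E n \<and> bell_time E n < t}"
    using assms by (auto simp: bells_def)
  moreover have "inj_on (bell_time E) N" for N
    by (rule strict_mono_imp_inj_on[OF strict_mono_bell_time[OF assms]])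
  ultimately show ?thesis
    by (simp add: bell_count_def card_image)
qed

lemma bells_locally_finite: "bells E m c \<in> locally_finite_points"
proof (cases "regular E")
  case True
  have "finite (bells E m c \<inter> {0..t})" for t
    by (rule finite_subset[OF _ finite_imageI[OF finite_bell_time_less[OF True, of "t + 1"], of "bell_time E"]])
      (auto simp: bells_def split: if_splits)
  then show ?thesis
    using bell_time_pos[OF True, THEN less_imp_le] by (auto simp: locally_finite_points_def bells_def)
qed (simp add: bells_def locally_finite_points_def)

lemma bells_measurable:
  "(\<lambda>\<omega>. bells (fst \<omega>) (snd \<omega>) c) \<in>
     stream_space borel \<Otimes>\<^sub>M stream_space (count_space UNIV) \<rightarrow>\<^sub>M point_space"
  (is "_ \<in> ?M \<rightarrow>\<^sub>M _")
  unfolding point_space_def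
proof (rule measurable_measure_of)
  fix G assume "G \<in> {{S \<in> locally_finite_points. card (S \<inter> {s..<t}) = n} | s t n. 0 \<le> s \<and> s < t}"
  then obtain s t n where G: "G = {S \<in> locally_finite_points. card (S \<inter> {s..<t}) = n}"
    by auto
  have [measurable]: "Measurable.pred ?M (\<lambda>\<omega>. regular (fst \<omega>))"
    by measurable
  have "(\<lambda>\<omega>. bells (fst \<omega>) (snd \<omega>) c) -` G \<inter> space ?M =
      {\<omega> \<in> space ?M. regular (fst \<omega>) \<and> bell_count (fst \<omega>) (snd \<omega>) c s t = n \<or>
        \<not> regular (fst \<omega>) \<and> n = 0}"
  proof -
    have "card (bells E m c \<inter> {s..<t}) = (if regular E then bell_count E m c s t else 0)" for E m
      using card_bells[of E] by (simp add: bells_def)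
    then show ?thesis
      unfolding G by (auto simp: bells_locally_finite)
  qed
  also have "\<dots> \<in> sets ?M"
    by measurable
  finally show "(\<lambda>\<omega>. bells (fst \<omega>) (snd \<omega>) c) -` G \<inter> space ?M \<in> sets ?M" .
qed (auto simp: bells_locally_finite)

abbreviation marked_gaps :: "real \<Rightarrow> real \<Rightarrow> (real stream \<times> bool stream) measure" where
  "marked_gaps l p \<equiv> gaps l \<Otimes>\<^sub>M coins p"

lemma sets_marked_gaps:
  "sets (marked_gaps l p) = sets (stream_space borel \<Otimes>\<^sub>M stream_space (count_space UNIV))"
  by (intro sets_pair_measure_cong sets_gaps sets_stream_space_pmf)

section \<open>Joint counts of the two bell processes\<close>

lemma grid_counts_map:
  "grid_counts (g j) (map (\<lambda>i. (g (Suc i) - g i, a i, b i)) [j..<r]) E m \<longleftrightarrow>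
    (\<forall>i\<in>{j..<r}. bell_count E m True (g i) (g (Suc i)) = a i \<and> bell_count E m False (g i) (g (Suc i)) = b i)"
proof (induction "r - j" arbitrary: j)
  case (Suc n)
  then have "j < r" "n = r - Suc j"
    by auto
  moreover have "{j..<r} = insert j {Suc j..<r}"
    using \<open>j < r\<close> by auto
  ultimately show ?case
    using Suc.hyps(1)[of "Suc j"] by (simp add: upt_rec[of j])
qed simp

lemma grid_prob_map:
  assumes "0 < l" "0 \<le> p" "p \<le> 1" "\<And>i. 0 \<le> d i"
  shows "grid_prob l p (map (\<lambda>i. (d i, a i, b i)) is) =
    (\<Prod>i\<leftarrow>is. ennreal (poisson_weight (l * p * d i) (a i) * poisson_weight (l * (1 - p) * d i) (b i)))"
proof (induction "is")
  case (Cons i "is")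
  then show ?case
    using grid_prob_Cons[OF assms, of "map (\<lambda>i. (d i, a i, b i)) is"] assms(4) by auto
qed (simp add: grid_prob_Nil assms(1))

lemma prob_space_gaps: "0 < l \<Longrightarrow> prob_space (gaps l)"
  by (intro prob_space.prob_space_stream_space prob_space_exponential_density)

lemma prob_space_stream_space_pmf: "prob_space (stream_space (measure_pmf q))"
  by (intro prob_space.prob_space_stream_space prob_space_measure_pmf)

lemma marked_gaps_grid:
  fixes g :: "nat \<Rightarrow> real" and k :: "bool \<Rightarrow> nat \<Rightarrow> nat"
  assumes l: "0 < l" and p: "0 \<le> p" "p \<le> 1" and g: "mono g" "g 0 = 0"
  shows "measure (marked_gaps l p)
      {\<omega>. \<forall>i<r. \<forall>c. card (bells (fst \<omega>) (snd \<omega>) c \<inter> {g i..<g (Suc i)}) = k c i} =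
    (\<Prod>i<r. \<Prod>c\<in>UNIV. poisson_weight ((if c then l * p else l * (1 - p)) * (g (Suc i) - g i)) (k c i))"
    (is "measure ?M ?A = _")
proof -
  interpret gaps: prob_space "gaps l"
    using l by (rule prob_space_gaps)
  interpret coins: prob_space "coins p"
    by (rule prob_space_stream_space_pmf)
  interpret pair_prob_space "gaps l" "coins p" ..
  note [measurable_cong] = sets_marked_gaps
  have space: "space ?M = UNIV"
    by (simp add: space_pair_measure)
  have d: "0 \<le> g (Suc i) - g i" for i
    using g(1) by (simp add: monoD)
  let ?xs = "map (\<lambda>i. (g (Suc i) - g i, k True i, k False i)) [0..<r]"
  let ?w = "\<lambda>i. poisson_weight (l * p * (g (Suc i) - g i)) (k True i) *
    poisson_weight (l * (1 - p) * (g (Suc i) - g i)) (k False i)"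
  have w: "0 \<le> ?w i" for i
    using l p d[of i] by (intro mult_nonneg_nonneg poisson_weight_nonneg) auto
  let ?B = "{\<omega> \<in> space ?M. grid_counts 0 ?xs (fst \<omega>) (snd \<omega>)}"
  have B: "?B \<in> sets ?M"
    by measurable
  have A: "?A \<in> sets ?M"
  proof -
    have "(\<lambda>\<omega>. card (bells (fst \<omega>) (snd \<omega>) c \<inter> {g i..<g (Suc i)})) \<in> ?M \<rightarrow>\<^sub>M count_space UNIV" for c i
      using measurable_compose[OF bells_measurable card_point_measurable[of "g i"]] monoD[OF g(1), of 0 i] g(2)
      by (simp add: measurable_cong_sets[OF sets_marked_gaps refl])
    then have "{\<omega> \<in> space ?M. \<forall>i<r. \<forall>c. card (bells (fst \<omega>) (snd \<omega>) c \<inter> {g i..<g (Suc i)}) = k c i} \<in> sets ?M"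
      by measurable
    then show ?thesis
      by (simp add: space)
  qed
  have "AE \<omega> in ?M. regular (fst \<omega>)"
  proof (rule AE_pair_measure)
    show "{\<omega> \<in> space ?M. regular (fst \<omega>)} \<in> sets ?M"
      by measurable
    show "AE E in gaps l. AE m in coins p. regular (fst (E, m))"
      using AE_regular[OF l] by simp
  qed
  \<comment> \<open>The events are identified on \<open>regular\<close> paths only, where
    cardinalities of \<open>bells\<close> are values of \<open>bell_count\<close>.\<close>
  then have "AE \<omega> in ?M. \<omega> \<in> ?A \<longleftrightarrow> \<omega> \<in> ?B"
  proof eventually_elim
    case (elim \<omega>)
    then show ?case
      using grid_counts_map[of g 0 "k True" "k False" r "fst \<omega>" "snd \<omega>"] g(2)
      by (auto simp: space card_bells all_bool_eq)
  qed
  then have "emeasure ?M ?A = emeasure ?M ?B"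
    using A B by (rule emeasure_eq_AE)
  also have "\<dots> = grid_prob l p ?xs"
    unfolding grid_prob_def using B
    by (subst coins.emeasure_pair_measure_alt) (auto intro!: nn_integral_cong arg_cong[where f = "emeasure _"] simp: space)
  also have "\<dots> = (\<Prod>i\<leftarrow>[0..<r]. ennreal (?w i))"
    by (rule grid_prob_map[OF l p d])
  also have "\<dots> = ennreal (\<Prod>i<r. ?w i)"
    using w by (subst prod_ennreal[symmetric]) (simp_all add: prod.distinct_set_conv_list[symmetric] atLeast0LessThan)
  finally have "measure ?M ?A = (\<Prod>i<r. ?w i)"
    using w by (simp add: emeasure_eq_measure prod_nonneg)
  then show ?thesis
    by (simp add: UNIV_bool mult.commute)
qed

text \<open>One space \<open>distr N K W\<close> has to carry two pairs of processes, each with a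
  law known through its own map \<Phi> to marked gaps. Keeping \<Phi> apart from \<open>W\<close>
  and linking them by \<open>Z_W\<close> allows both pairs to be treated by the same
  argument.\<close>

lemma poisson_grid_counts_distr:
  fixes W :: "'a \<Rightarrow> 'w"
  assumes l: "0 < l" and p: "0 < p" "p < 1" and N: "prob_space N"
    and \<Phi>: "\<Phi> \<in> N \<rightarrow>\<^sub>M marked_gaps l p" "distr N (marked_gaps l p) \<Phi> = marked_gaps l p"
    and W: "W \<in> N \<rightarrow>\<^sub>M K"
    and Z: "\<And>c. Z c \<in> K \<rightarrow>\<^sub>M point_space"
    and Z_W: "\<And>\<omega> c. \<omega> \<in> space N \<Longrightarrow> Z c (W \<omega>) = bells (fst (\<Phi> \<omega>)) (snd (\<Phi> \<omega>)) c"
  shows "poisson_grid_counts (distr N K W) (\<lambda>c. if c then l * p else l * (1 - p)) Z"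
proof -
  interpret N: prob_space N by (rule N)
  interpret M: prob_space "distr N K W"
    using W by (rule N.prob_space_distr)
  show ?thesis
  proof
    show "0 < (if c then l * p else l * (1 - p))" for c
      using l p by simp
    show "Z c \<in> distr N K W \<rightarrow>\<^sub>M point_space" for c
      using Z by simp
    fix g :: "nat \<Rightarrow> real" and r and k :: "bool \<Rightarrow> nat \<Rightarrow> nat"
    assume g: "mono g" "g 0 = 0"
    have card: "(\<lambda>S. card (S \<inter> {g i..<g (Suc i)})) \<in> point_space \<rightarrow>\<^sub>M count_space UNIV" for i
      using monoD[OF g(1), of 0 i] g(2) by (intro card_point_measurable) simp
    let ?P = "\<lambda>Z. \<forall>i<r. \<forall>c. card (Z c \<inter> {g i..<g (Suc i)}) = k c i"
    have [measurable]: "(\<lambda>\<omega>. card (Z c \<omega> \<inter> {g i..<g (Suc i)})) \<in> K \<rightarrow>\<^sub>M count_space UNIV" for c i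
      by (rule measurable_compose[OF Z card])
    have [measurable]: "(\<lambda>\<omega>. card (bells (fst \<omega>) (snd \<omega>) c \<inter> {g i..<g (Suc i)})) \<in>
        marked_gaps l p \<rightarrow>\<^sub>M count_space UNIV" for c i
      using measurable_compose[OF bells_measurable card]
      by (simp add: measurable_cong_sets[OF sets_marked_gaps refl])
    have K: "{\<omega> \<in> space K. ?P (\<lambda>c. Z c \<omega>)} \<in> sets K"
      by measurable
    have Q: "{\<omega> \<in> space (marked_gaps l p). ?P (bells (fst \<omega>) (snd \<omega>))} \<in> sets (marked_gaps l p)"
      by measurable
    have "M.prob {\<omega> \<in> space (distr N K W). ?P (\<lambda>c. Z c \<omega>)} =
        N.prob (W -` {\<omega> \<in> space K. ?P (\<lambda>c. Z c \<omega>)} \<inter> space N)"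
      using measure_distr[OF W K] by simp
    also have "W -` {\<omega> \<in> space K. ?P (\<lambda>c. Z c \<omega>)} \<inter> space N =
        \<Phi> -` {\<omega> \<in> space (marked_gaps l p). ?P (bells (fst \<omega>) (snd \<omega>))} \<inter> space N"
      using measurable_space[OF W] measurable_space[OF \<Phi>(1)] by (auto simp: Z_W)
    also have "N.prob \<dots> = measure (marked_gaps l p) {\<omega> \<in> space (marked_gaps l p). ?P (bells (fst \<omega>) (snd \<omega>))}"
      using measure_distr[OF \<Phi>(1) Q] \<Phi>(2) by simp
    also have "\<dots> = (\<Prod>i<r. \<Prod>c\<in>UNIV. poisson_weight ((if c then l * p else l * (1 - p)) * (g (Suc i) - g i)) (k c i))"
      using marked_gaps_grid[OF l _ _ g, of p r k] p by (simp add: space_pair_measure)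
    finally show "M.prob {\<omega> \<in> space (distr N K W). ?P (\<lambda>c. Z c \<omega>)} =
        (\<Prod>i<r. \<Prod>c\<in>UNIV. poisson_weight ((if c then l * p else l * (1 - p)) * (g (Suc i) - g i)) (k c i))" .
  qed
qed

lemma distr_marked_gaps:
  assumes "f \<in> blocks q \<rightarrow>\<^sub>M coins p" "distr (blocks q) (coins p) f = coins p" "0 < l"
  shows "distr (gaps l \<Otimes>\<^sub>M blocks q) (marked_gaps l p) (\<lambda>(E, bl). (E, f bl)) = marked_gaps l p"
proof -
  interpret coins: prob_space "coins p"
    by (rule prob_space_stream_space_pmf)
  have "distr (gaps l) (gaps l) (\<lambda>E. E) \<Otimes>\<^sub>M distr (blocks q) (coins p) f =
      distr (gaps l \<Otimes>\<^sub>M blocks q) (marked_gaps l p) (\<lambda>(E, bl). (E, f bl))"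
    using assms(1,2) by (intro pair_measure_distr) (auto intro: coins.sigma_finite_measure_axioms)
  then show ?thesis
    by (simp add: assms(2) distr_id2)
qed

theorem theorem8:
  fixes x y :: real
  assumes "x > 0" and "y > 0"
  shows "\<exists>(M :: (real set \<times> real set \<times> real set \<times> real set) measure) A B A' B'.
    prob_space M \<and>
    indep_poisson_processes M (1 / x) (1 / y) A B \<and>
    indep_poisson_processes M (1 / y) (1 / x) A' B' \<and>
    (\<forall>L \<in> locally_finite_points.
      \<forall>\<eta> \<in> {(False, False), (True, True), (True, False)}.
        AE \<omega> in M. output_flux L (A \<omega>) (B \<omega>) \<eta> = output_flux L (A' \<omega>) (B' \<omega>) \<eta>)"
proof -
  define l where "l = 1 / x + 1 / y"
  \<comment> \<open>Chosen so that left bells have rate \<open>l * p = 1 / x\<close> and right bells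
    \<open>l * (1 - p) = 1 / y\<close>; passing to \<open>1 - p\<close> exchanges these
    rates.\<close>
  define p where "p = 1 / x / l"
  have l: "0 < l"
    using assms by (simp add: l_def add_pos_pos)
  have lp: "l * p = 1 / x" "l * (1 - p) = 1 / y"
    using l by (simp_all add: p_def right_diff_distrib) (simp add: l_def)
  have p: "0 < p" "p < 1"
    using assms l lp zero_less_mult_pos[OF _ l, of p] zero_less_mult_pos[OF _ l, of "1 - p"] by auto
  let ?N = "gaps l \<Otimes>\<^sub>M blocks p"
  let ?m' = "\<lambda>bl. marks (smap prod.swap bl)"
  let ?W = "\<lambda>(E, bl). (bells E (marks bl) True, bells E (marks bl) False,
    bells E (?m' bl) True, bells E (?m' bl) False)"
  let ?S = "point_space \<Otimes>\<^sub>M point_space \<Otimes>\<^sub>M point_space \<Otimes>\<^sub>M point_space"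
  \<comment> \<open>On the range of \<open>?W\<close> the two pairs of bell processes are matched surely, so that no
    measurability of this relation is needed.\<close>
  define K where "K = restrict_space ?S (range ?W)"
  define M where "M = distr ?N K ?W"
  interpret gaps: prob_space "gaps l"
    using l by (rule prob_space_gaps)
  interpret blocks: prob_space "blocks p"
    by (rule prob_space_stream_space_pmf)
  interpret N: pair_prob_space "gaps l" "blocks p" ..
  have m: "marks \<in> blocks p \<rightarrow>\<^sub>M coins p"
    using marks_measurable by (simp cong: measurable_cong_sets add: sets_stream_space_pmf)
  have m': "?m' \<in> blocks p \<rightarrow>\<^sub>M coins (1 - p)"
    using measurable_compose[OF measurable_smap marks_measurable, of prod.swap "count_space UNIV"]
    by (simp cong: measurable_cong_sets add: sets_stream_space_pmf)
  \<comment> \<open>Exchanging block lengths gives \<open>blocks (1 - p)\<close>, whose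
    concatenation is a coin sequence with parameter \<open>1 - p\<close>.\<close>
  have "distr (blocks p) (coins (1 - p)) ?m' =
      distr (distr (blocks p) (stream_space (count_space UNIV)) (smap prod.swap)) (coins (1 - p)) marks"
    using marks_measurable measurable_smap[of prod.swap "count_space UNIV" "count_space UNIV"]
    by (subst distr_distr) (auto simp: comp_def sets_stream_space_pmf cong: measurable_cong_sets)
  then have distr_m': "distr (blocks p) (coins (1 - p)) ?m' = coins (1 - p)"
    using distr_marks_blocks[of "1 - p"] p by (simp add: distr_swap_blocks)
  let ?\<Phi> = "\<lambda>(E, bl). (E, marks bl)"
  let ?\<Phi>' = "\<lambda>(E, bl). (E, ?m' bl)"
  have \<Phi>: "?\<Phi> \<in> ?N \<rightarrow>\<^sub>M marked_gaps l p" and \<Phi>': "?\<Phi>' \<in> ?N \<rightarrow>\<^sub>M marked_gaps l (1 - p)"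
    using m m' by measurable
  have bells: "(\<lambda>\<omega>. bells (fst \<omega>) (snd \<omega>) c) \<in> marked_gaps l q \<rightarrow>\<^sub>M point_space" for q c
    using bells_measurable by (simp add: measurable_cong_sets[OF sets_marked_gaps refl])
  have W: "?W \<in> ?N \<rightarrow>\<^sub>M K"
    unfolding K_def
  proof (rule measurable_restrict_space2)
    show "?W \<in> ?N \<rightarrow>\<^sub>M ?S"
      using measurable_compose[OF \<Phi> bells] measurable_compose[OF \<Phi>' bells]
      by (auto simp: case_prod_unfold intro!: measurable_Pair)
  qed auto
  let ?A = "\<lambda>\<omega> :: real set \<times> real set \<times> real set \<times> real set. fst \<omega>"
  let ?B = "\<lambda>\<omega> :: real set \<times> real set \<times> real set \<times> real set. fst (snd \<omega>)"
  let ?A' = "\<lambda>\<omega> :: real set \<times> real set \<times> real set \<times> real set. fst (snd (snd \<omega>))"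
  let ?B' = "\<lambda>\<omega> :: real set \<times> real set \<times> real set \<times> real set. snd (snd (snd \<omega>))"
  have coords: "?A \<in> K \<rightarrow>\<^sub>M point_space" "?B \<in> K \<rightarrow>\<^sub>M point_space"
    "?A' \<in> K \<rightarrow>\<^sub>M point_space" "?B' \<in> K \<rightarrow>\<^sub>M point_space"
    unfolding K_def by (rule measurable_restrict_space1, measurable)+
  have "poisson_grid_counts M (\<lambda>c. if c then l * p else l * (1 - p)) (\<lambda>c. if c then ?A else ?B)"
    unfolding M_def
    by (rule poisson_grid_counts_distr[OF l p N.prob_space_axioms \<Phi> distr_marked_gaps[OF m distr_marks_blocks[OF p] l] W])
      (auto simp: coords)
  from poisson_grid_counts.indep_poisson_processes[OF this]
  have AB: "indep_poisson_processes M (1 / x) (1 / y) ?A ?B"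
    by (simp add: lp)
  have "poisson_grid_counts M (\<lambda>c. if c then l * (1 - p) else l * (1 - (1 - p))) (\<lambda>c. if c then ?A' else ?B')"
    unfolding M_def using p
    by (intro poisson_grid_counts_distr[OF l _ _ N.prob_space_axioms \<Phi>' distr_marked_gaps[OF m' distr_m' l] W])
      (auto simp: coords)
  from poisson_grid_counts.indep_poisson_processes[OF this]
  have AB': "indep_poisson_processes M (1 / y) (1 / x) ?A' ?B'"
    by (simp add: lp)
  have M: "prob_space M"
    unfolding M_def using W by (rule N.prob_space_distr)
  have "AE \<omega> in M. output_flux L (?A \<omega>) (?B \<omega>) \<eta> = output_flux L (?A' \<omega>) (?B' \<omega>) \<eta>"
    if L: "L \<in> locally_finite_points" and \<eta>: "\<eta> \<in> {(False, False), (True, True), (True, False)}" for L \<eta>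
  proof -
    \<comment> \<open>A locally finite set is a countable union of finite sets, so the bells almost
      surely avoid it.\<close>
    have "L = (\<Union>n. L \<inter> {0..real n})"
      using L by (auto simp: locally_finite_points_def real_arch_simple)
    moreover have "countable (\<Union>n. L \<inter> {0..real n})"
      using L by (intro countable_UN) (auto simp: locally_finite_points_def intro: countable_finite)
    ultimately have L': "countable L" "L \<subseteq> {0..}"
      using L by (auto simp: locally_finite_points_def)
    have "AE \<omega> in M. L \<inter> ?A \<omega> = {}"
      using assms AB by (intro poisson_process_avoids[OF M, of "1 / x"] L')
        (simp_all add: indep_poisson_processes_def)
    moreover have "AE \<omega> in M. L \<inter> ?B \<omega> = {}"
      using assms AB by (intro poisson_process_avoids[OF M, of "1 / y"] L')
        (simp_all add: indep_poisson_processes_def)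
    ultimately show ?thesis
      using AE_space[of M]
    proof eventually_elim
      case (elim \<omega>)
      then have "\<omega> \<in> range ?W"
        by (auto simp: M_def K_def space_restrict_space)
      then obtain E bl where \<omega>: "\<omega> = ?W (E, bl)"
        by auto
      \<comment> \<open>Off \<open>regular\<close> all four bell processes are empty and the two
        fluxes coincide trivially.\<close>
      show ?case
      proof (cases "regular E")
        case True
        have "L \<inter> range (bell_time E) = {}"
          using elim(1,2) True by (auto simp: \<omega> bells_def)
        then have "output_flux L (bell_time E ` {n. marks bl !! n}) (bell_time E ` {n. \<not> marks bl !! n}) \<eta> =
            output_flux L (bell_time E ` {n. ?m' bl !! n}) (bell_time E ` {n. \<not> ?m' bl !! n}) \<eta>"
          using L \<eta> strict_mono_bell_time[OF True] less_imp_le[OF bell_time_pos[OF True]]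
            finite_bell_time_less[OF True] marks_swap_descents[of bl, symmetric]
          by (intro output_flux_cong_descents)
        then show ?thesis
          using True by (simp add: \<omega> bells_def)
      qed (simp add: \<omega> bells_def)
    qed
  qed
  with M AB AB' show ?thesis
    by blast
qed

end
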